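(* Let $1\le p<\infty$ and let $m\ge1$ be an integer. The inclusion map $W^{m,p}\hookrightarrow L^p([0,1])$ is polynomial-time computable, where $W^{m,p}$ carries $\xi_{m,p}$ and $L^p([0,1])$ carries $\xi_{0,p}$.
   Context: Framework. $\Sigma=\{0,1\}$, $|a|$ string length, $1^n$ unary string. Fix a bijective pairing $\langle\cdot,\cdot\rangle$ on $\Sigma^*$, polynomial-time computable with polynomial-time projections, monotone in both arguments (iterated for tuples), and an encoding $a\mapsto[\![a]\!]$ of dyadic rationals by strings (binary expansion allowing arbitrarily long codes). A string function $\varphi$ is length-monotone if $|a|\le|b|\Rightarrow|\varphi(a)|\le|\varphi(b)|$; its size is $|\varphi|(|a|):=|\varphi(a)|$. A second-order representation of $X$ is a partial surjection from length-monotone string functions onto $X$. Second-order polynomials: smallest class of $P:\mathbb{N}^{\mathbb{N}}\times\mathbb{N}\to\mathbb{N}$ containing $(l,n)\mapsto p(n)$ for integer polynomials $p$, closed under $+,\cdot$ and $P\mapsto((l,n)\mapsto l(P(l,n)))$. A map $f:X\to Y$ of represented spaces is polynomial-time computable if there are an oracle Turing machine $M$ and a second-order polynomial $P$ such that whenever $\varphi$ names $x$, $a\mapsto M^\varphi(a)$ names $f(x)$, and $M^\varphi(a)$ halts within $P(|\varphi|,|a|)$ steps. Weak derivative of $f\in L^1([0,1])$: $f'\in L^1$ with $\int fg'=-\int f'g$ for all $g\in C^\infty([0,1])$, $g(0)=g(1)=0$; $f^{(k)}$ the $k$-fold iterate. $W^{m,p}$: the $f\in L^p([0,1])$ with $f',\dots,f^{(m)}$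 existing in $L^p$. $\tilde g$ is $g$ extended by zero to $\mathbb{R}$, $(\tau_hg)(x)=g(x+h)$. An $L^p$-modulus of $g$ is $\mu:\mathbb{N}\to\mathbb{N}$ with $|h|\le2^{-\mu(n)}\Rightarrow\|\tilde g-\tau_h\tilde g\|_p<2^{-n}$, and $\mu(n)\ne0\Rightarrow\mu(n+1)>\mu(n)$. $\xi_{k,p}$: a length-monotone $\varphi$ names $f\in W^{k,p}$ iff $\left|\int_{[\![a]\!]}^{[\![b]\!]}f\,d\lambda-[\![\varphi(\langle a,b,1^n\rangle)]\!]\right|<2^{-n}$ for all $a,b$ with $[\![a]\!],[\![b]\!]\in[0,1]$ and all $n$, and $|\varphi|$ is an $L^p$-modulus of $f^{(k)}$ ($f^{(0)}=f$, $W^{0,p}=L^p([0,1])$). *)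

theory Defs
  imports "HOL-Analysis.Analysis" "HOL-Computational_Algebra.Polynomial"
begin

section \<open>Strings, string functions, second-order polynomials\<close>

type_synonym bits = "bool list"

definition length_monotone :: "(bits \<Rightarrow> bits) \<Rightarrow> bool" where
  "length_monotone \<phi> \<longleftrightarrow> (\<forall>a b. length a \<le> length b \<longrightarrow> length (\<phi> a) \<le> length (\<phi> b))"

text \<open>The size is defined through the unary string of length \<open>n\<close>; for length-monotone
  functions every other string of that length gives the same value (next lemma).\<close>

definition fsize :: "(bits \<Rightarrow> bits) \<Rightarrow> nat \<Rightarrow> nat" where
  "fsize \<phi> n = length (\<phi> (replicate n True))"

lemma fsize_length: "length_monotone \<phi> \<Longrightarrow> fsize \<phi> (length a) = length (\<phi> a)"
  unfolding length_monotone_def fsize_def by (intro antisym) simp_all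

inductive second_order_poly :: "((nat \<Rightarrow> nat) \<Rightarrow> nat \<Rightarrow> nat) \<Rightarrow> bool" where
  base: "(\<And>n. 0 \<le> poly p (int n)) \<Longrightarrow> second_order_poly (\<lambda>l n. nat (poly p (int n)))"
| add: "second_order_poly P \<Longrightarrow> second_order_poly Q \<Longrightarrow> second_order_poly (\<lambda>l n. P l n + Q l n)"
| mult: "second_order_poly P \<Longrightarrow> second_order_poly Q \<Longrightarrow> second_order_poly (\<lambda>l n. P l n * Q l n)"
| app: "second_order_poly P \<Longrightarrow> second_order_poly (\<lambda>l n. l (P l n))"


section \<open>Oracle Turing machines\<close>

text \<open>Multitape machines with two-way infinite tapes over the alphabet 0, 1, blank, where
  \<open>None\<close> is the blank. Tape 0 is the query tape, tape 1 the answer tape, tape 2 the output tape;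
  the inputs are on the tapes from index 3 on, and all remaining tapes are work tapes. A string on
  a tape starts in cell 0 and ends before the first blank.\<close>

type_synonym tape = "(int \<Rightarrow> bool option) \<times> int"

datatype direction = Lft | Stay | Rgt

fun offset :: "direction \<Rightarrow> int" where
  "offset Lft = -1" | "offset Stay = 0" | "offset Rgt = 1"

record otm =
  n_tapes :: nat
  n_states :: nat
  trans :: "nat \<Rightarrow> bool option list \<Rightarrow> nat \<times> (bool option \<times> direction) list"

type_synonym config = "nat \<times> tape list"

abbreviation (input) "start_state \<equiv> (0::nat)"
abbreviation (input) "halt_state \<equiv> (1::nat)"
abbreviation (input) "query_state \<equiv> (2::nat)"
abbreviation (input) "answer_state \<equiv> (3::nat)"

text \<open>Only finitely many values of \<open>trans\<close> matter: states below \<open>n_states\<close> and symbol lists of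
  length \<open>n_tapes\<close>. The parameter \<open>r\<close> is the number of inputs.\<close>

definition wf_otm :: "nat \<Rightarrow> otm \<Rightarrow> bool" where
  "wf_otm r M \<longleftrightarrow> n_tapes M \<ge> 3 + r \<and> n_states M \<ge> 4 \<and>
     (\<forall>q < n_states M. \<forall>s. length s = n_tapes M \<longrightarrow>
        fst (trans M q s) < n_states M \<and> length (snd (trans M q s)) = n_tapes M)"

definition string_tape :: "bits \<Rightarrow> tape" where
  "string_tape w = (\<lambda>i. if 0 \<le> i \<and> i < int (length w) then Some (w ! nat i) else None, 0)"

definition tape_string :: "tape \<Rightarrow> bits" where
  "tape_string t = map (\<lambda>i. the (fst t (int i))) [0 ..< (LEAST n. fst t (int n) = None)]"

definition read_tape :: "tape \<Rightarrow> bool option" where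
  "read_tape t = fst t (snd t)"

fun act_tape :: "bool option \<times> direction \<Rightarrow> tape \<Rightarrow> tape" where
  "act_tape (x, d) (c, h) = (c(h := x), h + offset d)"

text \<open>A query is answered in one step: the answer replaces the contents of the answer tape, whose
  head is put back to cell 0.\<close>

fun otm_step :: "otm \<Rightarrow> (bits \<Rightarrow> bits) \<Rightarrow> config \<Rightarrow> config" where
  "otm_step M \<phi> (q, ts) =
     (if q = halt_state then (q, ts)
      else if q = query_state then
        (answer_state, ts[1 := string_tape (\<phi> (tape_string (ts ! 0)))])
      else let (q', acts) = trans M q (map read_tape ts) in (q', map2 act_tape acts ts))"

definition init_config :: "otm \<Rightarrow> bits list \<Rightarrow> config" where
  "init_config M ws =
     (start_state, replicate 3 (string_tape []) @ map string_tape ws @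
        replicate (n_tapes M - 3 - length ws) (string_tape []))"

definition computes_within :: "otm \<Rightarrow> (bits \<Rightarrow> bits) \<Rightarrow> bits list \<Rightarrow> bits \<Rightarrow> nat \<Rightarrow> bool" where
  "computes_within M \<phi> ws v t \<longleftrightarrow>
     (\<exists>t' \<le> t. \<exists>ts. (otm_step M \<phi> ^^ t') (init_config M ws) = (halt_state, ts) \<and>
        tape_string (ts ! 2) = v)"

text \<open>Ordinary polynomial-time computability of an \<open>r\<close>-ary string function: the machine never
  enters the query state, so that the oracle passed to it is irrelevant.\<close>

definition polytime_fun :: "nat \<Rightarrow> (bits list \<Rightarrow> bits) \<Rightarrow> bool" where
  "polytime_fun r f \<longleftrightarrow>
     (\<exists>M (p :: nat poly). wf_otm r M \<and>
        (\<forall>q < n_states M. \<forall>s. length s = n_tapes M \<longrightarrow> fst (trans M q s) \<noteq> query_state) \<and>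
        (\<forall>ws. length ws = r \<longrightarrow>
           computes_within M (\<lambda>_. []) ws (f ws) (poly p (sum_list (map length ws)))))"

text \<open>A represented space is given by its set of points \<open>X\<close> and the relation
  \<open>\<delta> \<phi> x\<close> that \<open>\<phi>\<close> is a name of \<open>x\<close>.\<close>

definition polytime_computable ::
  "'x set \<Rightarrow> ((bits \<Rightarrow> bits) \<Rightarrow> 'x \<Rightarrow> bool) \<Rightarrow> 'y set \<Rightarrow> ((bits \<Rightarrow> bits) \<Rightarrow> 'y \<Rightarrow> bool)
     \<Rightarrow> ('x \<Rightarrow> 'y) \<Rightarrow> bool" where
  "polytime_computable X \<delta> Y \<delta>' f \<longleftrightarrow> f ` X \<subseteq> Y \<and>
     (\<exists>M P. wf_otm 1 M \<and> second_order_poly P \<and>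
        (\<forall>\<phi>. \<forall>x \<in> X. length_monotone \<phi> \<and> \<delta> \<phi> x \<longrightarrow>
           (\<exists>\<psi>. \<delta>' \<psi> (f x) \<and>
              (\<forall>a. computes_within M \<phi> [a] (\<psi> a) (P (fsize \<phi>) (length a))))))"


section \<open>Pairing and dyadic rationals\<close>

text \<open>Monotonicity of the pairing refers to the length-lexicographic order, i.e. the order of the
  natural numbers under the standard enumeration of strings, as for the Cantor pairing. (It cannot
  mean monotonicity of lengths with respect to lengths: counting strings of length 0, 1, 2, ...
  shows that no bijective pairing has that property.)\<close>

definition shortlex_le :: "bits \<Rightarrow> bits \<Rightarrow> bool" where
  "shortlex_le a b \<longleftrightarrow> a = b \<or> (a, b) \<in> lenlex {(False, True)}"

definition admissible_pairing :: "(bits \<Rightarrow> bits \<Rightarrow> bits) \<Rightarrow> bool" where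
  "admissible_pairing pr \<longleftrightarrow>
     bij (\<lambda>(a, b). pr a b) \<and>
     polytime_fun 2 (\<lambda>ws. pr (ws ! 0) (ws ! 1)) \<and>
     polytime_fun 1 (\<lambda>ws. fst (inv (\<lambda>(a, b). pr a b) (ws ! 0))) \<and>
     polytime_fun 1 (\<lambda>ws. snd (inv (\<lambda>(a, b). pr a b) (ws ! 0))) \<and>
     (\<forall>a a' b. shortlex_le a a' \<longrightarrow> shortlex_le (pr a b) (pr a' b)) \<and>
     (\<forall>a b b'. shortlex_le b b' \<longrightarrow> shortlex_le (pr a b) (pr a b'))"

text \<open>A code consists of a sign bit, the number \<open>k\<close> of binary digits before the point in the form
  \<open>1\<^sup>k0\<close>, and the digits of the binary expansion. Leading and trailing zero digits are allowed,
  so every dyadic rational has arbitrarily long codes. Every string is a code; missing digits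
  count as zero.\<close>

fun dyadic :: "bits \<Rightarrow> real" where
  "dyadic [] = 0"
| "dyadic (s # u) =
     (let k = length (takeWhile (\<lambda>x. x) u); ds = tl (dropWhile (\<lambda>x. x) u)
      in (if s then - 1 else 1) *
         (\<Sum>i < length ds. of_bool (ds ! i) * 2 powi (int k - 1 - int i)))"


section \<open>Lebesgue and Sobolev spaces on the unit interval\<close>

abbreviation unit_leb :: "real measure" where
  "unit_leb \<equiv> lebesgue_on {0..1}"

definition Lp_fun :: "real \<Rightarrow> (real \<Rightarrow> real) set" where
  "Lp_fun p = {f. f \<in> borel_measurable unit_leb \<and> integrable unit_leb (\<lambda>x. \<bar>f x\<bar> powr p)}"

text \<open>The points of the spaces are classes of functions modulo equality almost everywhere.\<close>

definition ae_class :: "(real \<Rightarrow> real) \<Rightarrow> (real \<Rightarrow> real) set" where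
  "ae_class f = {g \<in> borel_measurable unit_leb. AE x in unit_leb. g x = f x}"

definition Lp_space :: "real \<Rightarrow> (real \<Rightarrow> real) set set" where
  "Lp_space p = ae_class ` Lp_fun p"

text \<open>\<open>D k\<close> plays the role of the \<open>k\<close>-th derivative of the smooth function \<open>D 0\<close>, one-sided at the
  end points.\<close>

definition smooth_tower :: "(nat \<Rightarrow> real \<Rightarrow> real) \<Rightarrow> bool" where
  "smooth_tower D \<longleftrightarrow>
     (\<forall>k. \<forall>x \<in> {0..1}. (D k has_real_derivative D (Suc k) x) (at x within {0..1}))"

definition weak_deriv :: "(real \<Rightarrow> real) \<Rightarrow> (real \<Rightarrow> real) \<Rightarrow> bool" where
  "weak_deriv f f' \<longleftrightarrow> f \<in> Lp_fun 1 \<and> f' \<in> Lp_fun 1 \<and>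
     (\<forall>D. smooth_tower D \<and> D 0 0 = 0 \<and> D 0 1 = 0 \<longrightarrow>
        (LINT x|unit_leb. f x * D 1 x) = - (LINT x|unit_leb. f' x * D 0 x))"

primrec weak_deriv_iter :: "nat \<Rightarrow> (real \<Rightarrow> real) \<Rightarrow> (real \<Rightarrow> real) \<Rightarrow> bool" where
  "weak_deriv_iter 0 f g \<longleftrightarrow> g = f"
| "weak_deriv_iter (Suc k) f g \<longleftrightarrow> (\<exists>h. weak_deriv_iter k f h \<and> weak_deriv h g)"

definition sobolev_fun :: "nat \<Rightarrow> real \<Rightarrow> (real \<Rightarrow> real) set" where
  "sobolev_fun m p =
     {f \<in> Lp_fun p. \<forall>k \<in> {1..m}. \<exists>g. weak_deriv_iter k f g \<and> g \<in> Lp_fun p}"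

definition sobolev :: "nat \<Rightarrow> real \<Rightarrow> (real \<Rightarrow> real) set set" where
  "sobolev m p = ae_class ` sobolev_fun m p"

lemma sobolev_0: "sobolev 0 p = Lp_space p"
  by (simp add: sobolev_def sobolev_fun_def Lp_space_def)

definition zero_ext :: "(real \<Rightarrow> real) \<Rightarrow> real \<Rightarrow> real" where
  "zero_ext g x = (if x \<in> {0..1} then g x else 0)"

definition Lp_norm :: "real \<Rightarrow> (real \<Rightarrow> real) \<Rightarrow> real" where
  "Lp_norm p g = (LINT x|lebesgue. \<bar>g x\<bar> powr p) powr (1 / p)"

definition Lp_modulus :: "real \<Rightarrow> (real \<Rightarrow> real) \<Rightarrow> (nat \<Rightarrow> nat) \<Rightarrow> bool" where
  "Lp_modulus p g \<mu> \<longleftrightarrow>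
     (\<forall>n h. \<bar>h\<bar> \<le> (1 / 2) ^ \<mu> n \<longrightarrow>
        Lp_norm p (\<lambda>x. zero_ext g x - zero_ext g (x + h)) < (1 / 2) ^ n) \<and>
     (\<forall>n. \<mu> n \<noteq> 0 \<longrightarrow> \<mu> (Suc n) > \<mu> n)"

text \<open>Neither condition depends on the chosen representative \<open>f\<close> or on the version \<open>g\<close> of the
  weak derivative. The integral is oriented. Triples are nested to the right.\<close>

definition xi ::
  "(bits \<Rightarrow> bits \<Rightarrow> bits) \<Rightarrow> nat \<Rightarrow> real \<Rightarrow> (bits \<Rightarrow> bits) \<Rightarrow> (real \<Rightarrow> real) set \<Rightarrow> bool" where
  "xi pr k p \<phi> F \<longleftrightarrow> length_monotone \<phi> \<and> F \<in> sobolev k p \<and>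
     (\<exists>f \<in> F.
        (\<forall>a b n. dyadic a \<in> {0..1} \<and> dyadic b \<in> {0..1} \<longrightarrow>
           \<bar>(LINT x=ereal (dyadic a)..ereal (dyadic b)|lebesgue. f x)
              - dyadic (\<phi> (pr a (pr b (replicate n True))))\<bar> < (1 / 2) ^ n) \<and>
        (\<exists>g. weak_deriv_iter k f g \<and> Lp_modulus p g (fsize \<phi>)))"

end

theory Submission
  imports Defs
begin

text \<open>Trailing zeros do not change the number coded by a string, so a name of \<open>f\<close> for \<open>W\<^sup>m\<^sup>,\<^sup>p\<close> becomes
  one for \<open>L\<^sup>p\<close> as soon as its values are padded to lengths that form a modulus of \<open>f\<close>. Writing \<open>l\<close>
  for the size of the given name, such lengths are linear in \<open>n\<close> and \<open>l (n + c)\<close>, with a constant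
  \<open>c\<close> depending on \<open>m\<close>, \<open>p\<close> and the pairing only: the modulus of the \<open>m\<close>-th derivative bounds its
  norm by \<open>2 * 2 ^ l 0\<close>, since a shift by the whole unit interval separates a function from its
  translate. The integrals of \<open>f\<close> over a grid of mesh \<open>2\<^sup>-\<^sup>m\<close> are bounded by \<open>2 * 2 ^ l c\<close>. By finite
  differences both bounds together control \<open>f\<close> and its lower derivatives uniformly, by some \<open>K\<close>. A
  translation by \<open>h\<close> then changes \<open>f\<close> by at most \<open>3 * h * K powr p\<close> in the \<open>p\<close>-th power of the norm.\<close>

section \<open>Weak derivatives on the unit interval\<close>

text \<open>The weak derivative is tested only against smooth functions vanishing at both ends, so a
  version with classical derivatives has to be produced first; polynomials suffice as tests, by
  Weierstrass. Zero extension then limits the modulus: even for smooth \<open>f\<close> it may jump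
  at the end points, so the \<open>p\<close>-th power of the norm of an increment decays only like
  \<open>h\<close>, and \<open>q\<close>, the least integer not below \<open>p\<close>, enters the
  new modulus as a factor. The bounds on \<open>f\<close> depend on its name only through the number
  \<open>l c0\<close>. The machine uses \<open>l (n + c)\<close>, which dominates it; its query is
  the input prolonged by \<open>c\<close> ones, so nothing has to be decoded and the lengths stay a
  function of the length of the input. Lengths also bound values: a code of length \<open>k\<close>
  denotes a number of absolute value at most \<open>2 ^ k\<close>. Finally, a modulus has to
  increase strictly once it is nonzero. The number of padding rounds is therefore the maximum of
  \<open>l (n + c)\<close> and \<open>n\<close>, where \<open>n\<close> supplies the growth as long
  as the given size is zero.\<close>

lemma continuous_on_Icc_bounded:
  fixes k :: "real \<Rightarrow> real"
  assumes "continuous_on {a..b} k"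
  obtains C where "\<And>x. x \<in> {a..b} \<Longrightarrow> \<bar>k x\<bar> \<le> C"
proof -
  have "bounded (k ` {a..b})"
    using assms by (intro compact_imp_bounded compact_continuous_image) auto
  then show ?thesis
    using that unfolding bounded_iff by (metis imageI real_norm_def)
qed

section \<open>Vanishing moments and integration by parts\<close>

lemma integrable_mult_continuous:
  fixes z k :: "real \<Rightarrow> real"
  assumes "integrable (lebesgue_on {a..b}) z" "continuous_on {a..b} k"
  shows "integrable (lebesgue_on {a..b}) (\<lambda>x. z x * k x)"
proof -
  obtain C where C: "\<And>x. x \<in> {a..b} \<Longrightarrow> \<bar>k x\<bar> \<le> C"
    using continuous_on_Icc_bounded[OF assms(2)] by metis
  have [measurable]: "k \<in> borel_measurable (lebesgue_on {a..b})"
    using assms(2) by (rule continuous_imp_measurable_on_sets_lebesgue) simp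
  have [measurable]: "z \<in> borel_measurable (lebesgue_on {a..b})"
    using assms(1) by simp
  show ?thesis
  proof (rule Bochner_Integration.integrable_bound)
    show "integrable (lebesgue_on {a..b}) (\<lambda>x. C * z x)"
      using assms(1) by simp
    show "AE x in lebesgue_on {a..b}. norm (z x * k x) \<le> norm (C * z x)"
    proof (rule AE_I2)
      fix x assume "x \<in> space (lebesgue_on {a..b})"
      then have "\<bar>k x\<bar> \<le> \<bar>C\<bar>"
        using C[of x] by auto
      then show "norm (z x * k x) \<le> norm (C * z x)"
        by (simp add: abs_mult mult.commute mult_right_mono)
    qed
  qed simp
qed

lemma continuous_approx_poly:
  fixes k :: "real \<Rightarrow> real"
  assumes "continuous_on {a..b} k" "0 < e"
  obtains q where "\<And>x. x \<in> {a..b} \<Longrightarrow> \<bar>k x - poly q x\<bar> < e"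
proof -
  obtain g where g: "real_polynomial_function g" "\<And>x. x \<in> {a..b} \<Longrightarrow> \<bar>k x - g x\<bar> < e"
    using Stone_Weierstrass_real_polynomial_function[of "{a..b}" k e] assms by auto
  obtain c n where gc: "g = (\<lambda>x. \<Sum>i\<le>n. c i * x ^ i)"
    using real_polynomial_function_imp_sum[OF g(1)] by blast
  have "g x = poly (\<Sum>i\<le>n. monom (c i) i) x" for x
    by (simp add: gc poly_sum poly_monom)
  then show ?thesis
    using g(2) that by metis
qed

text \<open>Weierstrass extends the hypothesis from polynomials to continuous test functions. The
  natural test \<open>z\<close> need be neither continuous nor bounded; \<open>s\<close> squashes it
  into the interval from -1 to 1, and continuous functions converging to \<open>z\<close> almost
  everywhere, composed with \<open>s\<close>, are admissible tests under the majorant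
  \<open>\<bar>z x\<bar>\<close>. In the limit the nonnegative function \<open>z x * s (z x)\<close>
  has integral zero.\<close>

lemma moments_zero_imp_AE_zero:
  fixes z :: "real \<Rightarrow> real"
  assumes z: "integrable (lebesgue_on {a..b}) z"
    and moments: "\<And>q. (LINT x|lebesgue_on {a..b}. z x * poly q x) = 0"
  shows "AE x in lebesgue_on {a..b}. z x = 0"
proof -
  let ?M = "lebesgue_on {a..b}"
  have [measurable]: "z \<in> borel_measurable ?M"
    using z by simp
  have cont: "(LINT x|?M. z x * k x) = 0" if k: "continuous_on {a..b} k" for k
  proof -
    define I where "I = (LINT x|?M. \<bar>z x\<bar>)"
    have I: "0 \<le> I" unfolding I_def by (rule Bochner_Integration.integral_nonneg) simp
    have "\<bar>LINT x|?M. z x * k x\<bar> \<le> 0 + e" if e: "0 < e" for e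
    proof -
      have "0 < e / (I + 1)" using e I by (intro divide_pos_pos) linarith+
      then obtain q where q: "\<And>x. x \<in> {a..b} \<Longrightarrow> \<bar>k x - poly q x\<bar> < e / (I + 1)"
        using continuous_approx_poly[OF k] by blast
      have iq: "integrable ?M (\<lambda>x. z x * poly q x)" "integrable ?M (\<lambda>x. z x * k x)"
        by (auto intro!: integrable_mult_continuous z k continuous_intros)
      have "(LINT x|?M. z x * k x) = (LINT x|?M. z x * k x - z x * poly q x)"
        using iq moments[of q] by simp
      also have "\<bar>\<dots>\<bar> \<le> (LINT x|?M. \<bar>z x\<bar> * (e / (I + 1)))"
      proof (rule integral_abs_bound_integral)
        show "\<bar>z x * k x - z x * poly q x\<bar> \<le> \<bar>z x\<bar> * (e / (I + 1))" if "x \<in> space ?M" for x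
        proof -
          have "\<bar>z x * k x - z x * poly q x\<bar> = \<bar>z x\<bar> * \<bar>k x - poly q x\<bar>"
            by (simp add: abs_mult[symmetric] algebra_simps)
          also have "\<dots> \<le> \<bar>z x\<bar> * (e / (I + 1))"
            using q[of x] that by (intro mult_left_mono) auto
          finally show ?thesis .
        qed
      qed (use iq z in auto)
      also have "\<dots> = I * (e / (I + 1))"
        by (simp add: I_def)
      also have "\<dots> \<le> e"
        using I e by (simp add: field_simps)
      finally show ?thesis by simp
    qed
    then have "\<bar>LINT x|?M. z x * k x\<bar> \<le> 0"
      by (rule field_le_epsilon)
    then show ?thesis by simp
  qed
  let ?z = "\<lambda>x. if x \<in> {a..b} then z x else 0"
  have "?z \<in> borel_measurable lebesgue"
    by (subst borel_measurable_if) auto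
  then have "?z measurable_on UNIV"
    by (rule lebesgue_measurable_imp_measurable_on_real) simp
  then obtain N g where N: "negligible N" and g: "\<And>n. continuous_on UNIV (g n)"
    and lim: "\<And>x. x \<notin> N \<Longrightarrow> (\<lambda>n. g n x) \<longlonglongrightarrow> ?z x"
    unfolding measurable_on_def by auto
  define s :: "real \<Rightarrow> real" where "s y = y / (1 + \<bar>y\<bar>)" for y
  have s_le: "\<bar>s y\<bar> \<le> 1" for y
    by (simp add: s_def)
  have s_cont: "continuous_on UNIV s"
    unfolding s_def by (intro continuous_intros) (auto simp: add_nonneg_eq_0_iff)
  have AE: "AE x in ?M. x \<notin> N"
    using N by (intro AE_restrict_space_iff[THEN iffD2]) (auto simp: negligible_iff_null_sets intro!: AE_I2 AE_not_in elim!: eventually_mono[OF AE_not_in])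
  have "(\<lambda>n. LINT x|?M. z x * s (g n x)) \<longlonglongrightarrow> (LINT x|?M. z x * s (z x))"
  proof (rule integral_dominated_convergence)
    show "(\<lambda>x. z x * s (z x)) \<in> borel_measurable ?M"
      unfolding s_def by measurable
    show "(\<lambda>x. z x * s (g n x)) \<in> borel_measurable ?M" for n
    proof (rule borel_measurable_times)
      have "continuous_on {a..b} (\<lambda>x. s (g n x))"
        using continuous_on_compose2[OF s_cont continuous_on_subset[OF g]] by blast
      then show "(\<lambda>x. s (g n x)) \<in> borel_measurable ?M"
        by (rule continuous_imp_measurable_on_sets_lebesgue) simp
    qed simp
    show "integrable ?M (\<lambda>x. \<bar>z x\<bar>)"
      using z by simp
    show "AE x in ?M. (\<lambda>n. z x * s (g n x)) \<longlonglongrightarrow> z x * s (z x)"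
      using AE
    proof (rule AE_mp, intro AE_I2 impI)
      fix x assume x: "x \<in> space ?M" "x \<notin> N"
      then have "(\<lambda>n. g n x) \<longlonglongrightarrow> z x"
        using lim[of x] by simp
      then show "(\<lambda>n. z x * s (g n x)) \<longlonglongrightarrow> z x * s (z x)"
        using s_cont by (intro tendsto_intros isCont_tendsto_compose[of _ s]) (auto simp: continuous_on_eq_continuous_at)
    qed
    show "AE x in ?M. norm (z x * s (g n x)) \<le> \<bar>z x\<bar>" for n
      using s_le by (auto simp: abs_mult mult_left_le)
  qed
  moreover have "(LINT x|?M. z x * s (g n x)) = 0" for n
    by (rule cont) (rule continuous_on_compose2[OF s_cont continuous_on_subset[OF g]], auto)
  ultimately have 0: "(LINT x|?M. z x * s (z x)) = 0"
    by (simp add: LIMSEQ_const_iff)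
  have "integrable ?M (\<lambda>x. z x * s (z x))"
  proof (rule Bochner_Integration.integrable_bound[OF z])
    show "(\<lambda>x. z x * s (z x)) \<in> borel_measurable ?M"
      unfolding s_def by measurable
  qed (use s_le in \<open>auto simp: abs_mult mult_left_le\<close>)
  then have "AE x in ?M. z x * s (z x) = 0"
    using 0 integral_nonneg_eq_0_iff_AE[of ?M "\<lambda>x. z x * s (z x)"] by (auto simp: s_def)
  then show ?thesis
    by (rule eventually_mono) (auto simp: s_def add_nonneg_eq_0_iff)
qed

text \<open>The primitive \<open>H\<close> of \<open>v\<close> need not be differentiable
  everywhere, but the defect \<open>W\<close> of the formula is, with derivative zero: its increment
  from \<open>x\<close> to \<open>y\<close> is at most \<open>2 * C * (y - x)\<close> times the
  increment of \<open>A\<close>, and \<open>A\<close> is continuous.\<close>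

lemma integral_by_parts_indefinite:
  fixes v d d' :: "real \<Rightarrow> real"
  assumes ab: "a \<le> b" and v: "v absolutely_integrable_on {a..b}"
    and d: "\<And>x. x \<in> {a..b} \<Longrightarrow> (d has_real_derivative d' x) (at x within {a..b})"
    and d': "continuous_on {a..b} d'"
  shows "integral {a..b} (\<lambda>x. v x * d x) + integral {a..b} (\<lambda>x. integral {a..x} v * d' x)
    = integral {a..b} v * d b"
proof -
  define H where "H x = integral {a..x} v" for x
  define A where "A x = integral {a..x} (\<lambda>t. \<bar>v t\<bar>)" for x
  define W where "W x = H x * d x - integral {a..x} (\<lambda>t. v t * d t) - integral {a..x} (\<lambda>t. H t * d' t)" for x
  have vi: "v integrable_on {a..b}" and ai: "(\<lambda>t. \<bar>v t\<bar>) integrable_on {a..b}"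
    using v by (auto simp: absolutely_integrable_on_def)
  have Hc: "continuous_on {a..b} H" and Ac: "continuous_on {a..b} A"
    unfolding H_def A_def by (intro indefinite_integral_continuous_1 vi ai)+
  have dc: "continuous_on {a..b} d"
    by (rule DERIV_continuous_on[OF d])
  obtain C where C: "\<And>x. x \<in> {a..b} \<Longrightarrow> \<bar>d' x\<bar> \<le> C"
    using continuous_on_Icc_bounded[OF d'] by metis
  have C0: "0 \<le> C"
    using C[of a] ab by simp
  have vd: "(\<lambda>t. v t * d t) integrable_on {a..b}"
  proof -
    have "integrable (lebesgue_on {a..b}) (\<lambda>t. v t * d t)"
      using v by (intro integrable_mult_continuous dc) (simp add: integrable_restrict_space set_integrable_def)
    then show ?thesis by (rule integrable_on_lebesgue_on) simp
  qed
  have Hd: "(\<lambda>t. H t * d' t) integrable_on {a..b}"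
    by (intro integrable_continuous_real continuous_intros Hc d')
  have incr: "\<bar>W y - W x\<bar> \<le> 2 * C * (y - x) * (A y - A x)" if xy: "a \<le> x" "x \<le> y" "y \<le> b" for x y
  proof -
    have sub: "f integrable_on {x..y}" if "f integrable_on {a..b}" for f :: "real \<Rightarrow> real"
      using that xy by (auto intro: integrable_on_subinterval)
    have inc: "integral {a..y} f - integral {a..x} f = integral {x..y} f"
      if "f integrable_on {a..b}" for f :: "real \<Rightarrow> real"
      using Henstock_Kurzweil_Integration.integral_combine[of a x y f] xy
        integrable_on_subinterval[OF that, of a y] by simp
    have Ad: "A y - A x = integral {x..y} (\<lambda>t. \<bar>v t\<bar>)"
      unfolding A_def by (rule inc[OF ai])
    have Hdiff: "\<bar>H x - H t\<bar> \<le> A y - A x" if t: "t \<in> {x..y}" for t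
    proof -
      have "H t - H x = integral {x..t} v"
        unfolding H_def using Henstock_Kurzweil_Integration.integral_combine[of a x t v] xy t
          integrable_on_subinterval[OF vi, of a t] by simp
      moreover have "\<bar>integral {x..t} v\<bar> \<le> integral {x..t} (\<lambda>t. \<bar>v t\<bar>)"
        using integral_norm_bound_integral[of v "{x..t}" "\<lambda>t. \<bar>v t\<bar>"] xy t
          integrable_on_subinterval[OF vi, of x t] integrable_on_subinterval[OF ai, of x t] by auto
      moreover have "integral {x..t} (\<lambda>t. \<bar>v t\<bar>) \<le> integral {x..y} (\<lambda>t. \<bar>v t\<bar>)"
        using t xy by (intro integral_subset_le sub ai integrable_on_subinterval[OF ai]) auto
      ultimately show ?thesis
        using Ad by linarith
    qed
    have ddiff: "\<bar>d y - d t\<bar> \<le> C * (y - x)" if t: "t \<in> {x..y}" for t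
    proof -
      have "norm (d y - d t) \<le> C * norm (y - t)"
      proof (rule field_differentiable_bound[of "{a..b}" d d'])
        show "(d has_field_derivative d' z) (at z within {a..b})" if "z \<in> {a..b}" for z
          using d that by blast
      qed (use C xy t in auto)
      also have "\<dots> \<le> C * (y - x)"
        using t C0 by (intro mult_left_mono) auto
      finally show ?thesis by simp
    qed
    have d'int: "(d' has_integral d y - d x) {x..y}"
      using xy by (intro fundamental_theorem_of_calculus)
        (auto simp: has_real_derivative_iff_has_vector_derivative[symmetric] intro!: DERIV_subset[OF d])
    have i1: "((\<lambda>t. v t * d y - v t * d t) has_integral
        (H y - H x) * d y - integral {x..y} (\<lambda>t. v t * d t)) {x..y}"
      unfolding H_def inc[OF vi]
      by (intro has_integral_diff has_integral_mult_left integrable_integral sub vi vd)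
    have i2: "((\<lambda>t. H x * d' t - H t * d' t) has_integral
        H x * (d y - d x) - integral {x..y} (\<lambda>t. H t * d' t)) {x..y}"
      by (intro has_integral_diff has_integral_mult_right integrable_integral sub Hd d'int)
    have b1: "\<bar>(H y - H x) * d y - integral {x..y} (\<lambda>t. v t * d t)\<bar> \<le> C * (y - x) * (A y - A x)"
    proof -
      have "norm (integral {x..y} (\<lambda>t. v t * d y - v t * d t)) \<le> integral {x..y} (\<lambda>t. C * (y - x) * \<bar>v t\<bar>)"
      proof (rule integral_norm_bound_integral)
        show "norm (v t * d y - v t * d t) \<le> C * (y - x) * \<bar>v t\<bar>" if "t \<in> {x..y}" for t
        proof -
          have "norm (v t * d y - v t * d t) = \<bar>d y - d t\<bar> * \<bar>v t\<bar>"
            by (simp add: abs_mult[symmetric] algebra_simps)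
          then show ?thesis
            using ddiff[OF that] by (simp add: mult_right_mono)
        qed
      qed (use i1 integrable_on_mult_right[OF sub[OF ai]] in auto)
      then show ?thesis
        using i1 by (simp add: Ad integral_unique)
    qed
    have b2: "\<bar>H x * (d y - d x) - integral {x..y} (\<lambda>t. H t * d' t)\<bar> \<le> C * (y - x) * (A y - A x)"
    proof -
      have "norm (integral {x..y} (\<lambda>t. H x * d' t - H t * d' t)) \<le> integral {x..y} (\<lambda>t. C * (A y - A x))"
      proof (rule integral_norm_bound_integral)
        show "norm (H x * d' t - H t * d' t) \<le> C * (A y - A x)" if "t \<in> {x..y}" for t
        proof -
          have "norm (H x * d' t - H t * d' t) = \<bar>d' t\<bar> * \<bar>H x - H t\<bar>"
            by (simp add: abs_mult[symmetric] algebra_simps)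
          then show ?thesis
            using Hdiff[OF that] C[of t] that xy by (auto intro!: mult_mono C0)
        qed
      qed (use i2 in auto)
      then show ?thesis
        using i2 xy by (simp add: integral_unique algebra_simps)
    qed
    \<comment> \<open>The two brackets are the integrals over \<open>{x..y}\<close> of
      \<open>v t * (d y - d t)\<close> and of \<open>(H x - H t) * d' t\<close>.\<close>
    have "W y - W x = ((H y - H x) * d y - integral {x..y} (\<lambda>t. v t * d t))
        + (H x * (d y - d x) - integral {x..y} (\<lambda>t. H t * d' t))"
      unfolding W_def inc[OF vd, symmetric] inc[OF Hd, symmetric] by (simp add: algebra_simps)
    then show ?thesis
      using b1 b2 by (simp add: algebra_simps)
  qed
  have "(W has_field_derivative 0) (at x within {a..b})" if x: "x \<in> {a..b}" for x
    unfolding has_field_derivative_iff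
  proof (rule Lim_null_comparison)
    have "(A \<longlongrightarrow> A x) (at x within {a..b})"
      using Ac x by (simp add: continuous_on)
    then have "((\<lambda>y. 2 * C * \<bar>A y - A x\<bar>) \<longlongrightarrow> 2 * C * \<bar>A x - A x\<bar>) (at x within {a..b})"
      by (intro tendsto_intros)
    then show "((\<lambda>y. 2 * C * \<bar>A y - A x\<bar>) \<longlongrightarrow> 0) (at x within {a..b})"
      by simp
    have "norm ((W y - W x) / (y - x)) \<le> 2 * C * \<bar>A y - A x\<bar>" if y: "y \<in> {a..b}" "y \<noteq> x" for y
    proof -
      have "\<bar>W y - W x\<bar> \<le> 2 * C * \<bar>y - x\<bar> * \<bar>A y - A x\<bar>"
      proof (cases "x \<le> y")
        case True
        have "\<bar>W y - W x\<bar> \<le> 2 * C * (y - x) * (A y - A x)"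
          using incr[of x y] True x y by simp
        also have "\<dots> \<le> 2 * C * (y - x) * \<bar>A y - A x\<bar>"
          using C0 True by (intro mult_left_mono) auto
        finally show ?thesis using True by simp
      next
        case False
        have "\<bar>W x - W y\<bar> \<le> 2 * C * (x - y) * (A x - A y)"
          using incr[of y x] False x y by simp
        also have "\<dots> \<le> 2 * C * (x - y) * \<bar>A x - A y\<bar>"
          using C0 False by (intro mult_left_mono) auto
        finally show ?thesis using False by (simp add: abs_minus_commute)
      qed
      then show ?thesis
        using y by (simp add: abs_divide divide_simps algebra_simps)
    qed
    then show "\<forall>\<^sub>F y in at x within {a..b}. norm ((W y - W x) / (y - x)) \<le> 2 * C * \<bar>A y - A x\<bar>"
      by (auto simp: eventually_at_filter)
  qed
  then obtain w where w: "\<And>x. x \<in> {a..b} \<Longrightarrow> W x = w"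
    using has_field_derivative_zero_constant[of "{a..b}" W] by auto
  have "W b = W a"
    using w ab by simp
  then show ?thesis
    by (simp add: W_def H_def)
qed

section \<open>Polynomial test functions and classical versions of weakly differentiable
  functions\<close>

lemma Lp_fun_1: "f \<in> Lp_fun 1 \<longleftrightarrow> integrable unit_leb f"
proof
  assume "f \<in> Lp_fun 1"
  then have m: "f \<in> borel_measurable unit_leb" and "integrable unit_leb (\<lambda>x. \<bar>f x\<bar> powr 1)"
    by (auto simp: Lp_fun_def)
  then have "integrable unit_leb (\<lambda>x. \<bar>f x\<bar>)" by simp
  then show "integrable unit_leb f"
    using m integrable_abs_cancel by blast
qed (auto simp: Lp_fun_def)

lemma integrable_lebesgue_on_iff_absolutely:
  fixes f :: "real \<Rightarrow> real"
  shows "integrable (lebesgue_on {a..b}) f \<longleftrightarrow> f absolutely_integrable_on {a..b}"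
  by (simp add: integrable_restrict_space set_integrable_def)

lemma continuous_imp_integrable_lebesgue_on:
  fixes f :: "real \<Rightarrow> real"
  shows "continuous_on {a..b} f \<Longrightarrow> integrable (lebesgue_on {a..b}) f"
  by (simp add: integrable_lebesgue_on_iff_absolutely absolutely_integrable_continuous_real)

lemma ex_pderiv_eq:
  fixes q :: "real poly"
  shows "\<exists>Q. pderiv Q = q \<and> poly Q 0 = 0"
proof -
  have "pderiv (\<Sum>i\<le>n. monom (coeff q i / real (Suc i)) (Suc i)) = (\<Sum>i\<le>n. monom (coeff q i) i)" for n
    by (induction n) (simp_all add: pderiv_add pderiv_monom del: of_nat_Suc)
  then show ?thesis
    by (intro exI[of _ "\<Sum>i\<le>degree q. monom (coeff q i / real (Suc i)) (Suc i)"])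
      (simp add: poly_as_sum_of_monoms poly_sum poly_monom)
qed

lemma smooth_tower_poly: "smooth_tower (\<lambda>k x. poly ((pderiv ^^ k) q) x)"
  unfolding smooth_tower_def by (auto intro!: DERIV_subset[OF poly_DERIV])

lemma weak_deriv_poly:
  assumes "weak_deriv f g" "poly q 0 = 0" "poly q 1 = 0"
  shows "(LINT x|unit_leb. f x * poly (pderiv q) x) = - (LINT x|unit_leb. g x * poly q x)"
  using assms smooth_tower_poly[of q] unfolding weak_deriv_def
  by (auto dest!: spec[of _ "\<lambda>k x. poly ((pderiv ^^ k) q) x"])

lemma weak_deriv_integrable:
  assumes "weak_deriv u v"
  shows "integrable unit_leb u" "integrable unit_leb v"
  using assms by (auto simp: weak_deriv_def Lp_fun_1)

text \<open>The du Bois-Reymond lemma: \<open>u\<close> minus the primitive of \<open>v\<close>,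
  corrected by its mean \<open>c\<close>, is orthogonal to every polynomial.\<close>

lemma weak_deriv_AE_eq_integral:
  assumes uv: "weak_deriv u v"
  shows "\<exists>c. AE x in unit_leb. u x = c + integral {0..x} v"
proof -
  have u: "integrable unit_leb u" and v: "integrable unit_leb v"
    using weak_deriv_integrable[OF uv] by auto
  have va: "v absolutely_integrable_on {0..1}"
    using v by (simp add: integrable_lebesgue_on_iff_absolutely)
  define H where "H x = integral {0..x} v" for x
  have Hc: "continuous_on {0..1} H"
    unfolding H_def using va by (intro indefinite_integral_continuous_1) (simp add: absolutely_integrable_on_def)
  have Hi: "integrable unit_leb H"
    using Hc by (rule continuous_imp_integrable_lebesgue_on)
  define c where "c = (LINT x|unit_leb. u x - H x)"
  have "AE x in unit_leb. u x - H x - c = 0"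
  proof (rule moments_zero_imp_AE_zero)
    show "integrable unit_leb (\<lambda>x. u x - H x - c)"
      using u Hi by (auto intro!: Bochner_Integration.integrable_diff continuous_imp_integrable_lebesgue_on)
    fix q :: "real poly"
    obtain Q where Q: "pderiv Q = q" "poly Q 0 = 0"
      using ex_pderiv_eq by blast
    define s where "s = poly Q 1"
    \<comment> \<open>The linear term makes the primitive of \<open>q\<close> vanish at 1 as well,
      so that it is an admissible test function. The price is the constant \<open>s\<close>, the
      mean of \<open>q\<close>, for which \<open>c\<close> compensates.\<close>
    define R where "R = Q - monom s 1"
    have R: "pderiv R = q - [:s:]" "poly R 0 = 0" "poly R 1 = 0"
      using Q by (auto simp: R_def pderiv_diff pderiv_monom poly_monom s_def monom_0)
    have ci: "continuous_on {0..1} (\<lambda>x. poly r x)" for r :: "real poly"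
      by (intro continuous_intros)
    have qs: "(LINT x|unit_leb. poly q x) = s"
    proof -
      have "((\<lambda>x. poly q x) has_integral poly Q 1 - poly Q 0) {0..1}"
        using Q(1) by (intro fundamental_theorem_of_calculus)
          (auto simp: has_real_derivative_iff_has_vector_derivative[symmetric] intro!: DERIV_subset[OF poly_DERIV])
      then show ?thesis
        using Q(2) by (simp add: lebesgue_integral_eq_integral continuous_imp_integrable_lebesgue_on ci integral_unique s_def)
    qed
    have "(LINT x|unit_leb. u x * poly (pderiv R) x) = - (LINT x|unit_leb. v x * poly R x)"
      by (rule weak_deriv_poly[OF uv R(2,3)])
    moreover have "(LINT x|unit_leb. v x * poly R x) + (LINT x|unit_leb. H x * poly (pderiv R) x) = 0"
    proof -
      have "integral {0..1} (\<lambda>x. v x * poly R x) + integral {0..1} (\<lambda>x. integral {0..x} v * poly (pderiv R) x)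
          = integral {0..1} v * poly R 1"
        by (rule integral_by_parts_indefinite) (auto intro!: va ci DERIV_subset[OF poly_DERIV])
      then show ?thesis
        using R(3) v Hi unfolding H_def[symmetric]
        by (simp add: lebesgue_integral_eq_integral integrable_mult_continuous ci)
    qed
    ultimately have "(LINT x|unit_leb. u x * poly (pderiv R) x) = (LINT x|unit_leb. H x * poly (pderiv R) x)"
      by simp
    then have "(LINT x|unit_leb. u x * poly q x - u x * s) = (LINT x|unit_leb. H x * poly q x - H x * s)"
      by (simp add: R algebra_simps)
    then have 1: "(LINT x|unit_leb. u x * poly q x) - (LINT x|unit_leb. u x) * s
        = (LINT x|unit_leb. H x * poly q x) - (LINT x|unit_leb. H x) * s"
      using u Hi by (simp add: integrable_mult_continuous ci)
    have "(LINT x|unit_leb. (u x - H x - c) * poly q x)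
        = (LINT x|unit_leb. u x * poly q x - H x * poly q x - c * poly q x)"
      by (simp add: algebra_simps)
    also have "\<dots> = (LINT x|unit_leb. u x * poly q x) - (LINT x|unit_leb. H x * poly q x) - c * s"
      using u Hi by (simp add: integrable_mult_continuous ci continuous_imp_integrable_lebesgue_on qs)
    also have "\<dots> = 0"
      using 1 u Hi by (simp add: c_def algebra_simps)
    finally show "(LINT x|unit_leb. (u x - H x - c) * poly q x) = 0" .
  qed
  then have "AE x in unit_leb. u x = c + integral {0..x} v"
    by (rule eventually_mono) (simp add: H_def)
  then show ?thesis ..
qed

text \<open>Test functions have to vanish at 0 and 1, so the moments known to vanish are those of
  \<open>v1 - v2\<close> times \<open>x * (1 - x)\<close>, a factor that is nonzero off the end
  points.\<close>

lemma weak_deriv_AE_unique: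
  assumes "weak_deriv u1 v1" "weak_deriv u2 v2" "AE x in unit_leb. u1 x = u2 x"
  shows "AE x in unit_leb. v1 x = v2 x"
proof -
  note i1 = weak_deriv_integrable[OF assms(1)] and i2 = weak_deriv_integrable[OF assms(2)]
  let ?e = "[:0, 1, -1:] :: real poly"
  have ci: "continuous_on {0..1} (\<lambda>x. poly r x)" for r :: "real poly"
    by (intro continuous_intros)
  have "AE x in unit_leb. (v1 x - v2 x) * poly ?e x = 0"
  proof (rule moments_zero_imp_AE_zero)
    show "integrable unit_leb (\<lambda>x. (v1 x - v2 x) * poly ?e x)"
      using i1 i2 by (intro integrable_mult_continuous ci) auto
    fix q :: "real poly"
    let ?r = "?e * q"
    have "(LINT x|unit_leb. u1 x * poly (pderiv ?r) x) = (LINT x|unit_leb. u2 x * poly (pderiv ?r) x)"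
      using i1(1) i2(1) assms(3)
      by (intro integral_cong_AE) (auto intro!: borel_measurable_integrable integrable_mult_continuous ci elim: eventually_mono)
    then have "(LINT x|unit_leb. v1 x * poly ?r x) = (LINT x|unit_leb. v2 x * poly ?r x)"
      using weak_deriv_poly[OF assms(1), of ?r] weak_deriv_poly[OF assms(2), of ?r] by simp
    then have "(LINT x|unit_leb. v1 x * poly ?r x - v2 x * poly ?r x) = 0"
      using i1 i2 by (subst Bochner_Integration.integral_diff) (auto intro!: integrable_mult_continuous continuous_intros)
    then show "(LINT x|unit_leb. (v1 x - v2 x) * poly ?e x * poly q x) = 0"
      by (simp add: algebra_simps)
  qed
  moreover have "AE x in unit_leb. x \<noteq> 0 \<and> x \<noteq> 1"
  proof -
    have "AE x in lebesgue. x \<notin> {0, 1::real}"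
      by (rule AE_not_in) (simp add: negligible_iff_null_sets[symmetric])
    then show ?thesis
      by (subst AE_restrict_space_iff) (auto elim: eventually_mono)
  qed
  ultimately show ?thesis
    by eventually_elim auto
qed

lemma weak_deriv_iter_AE_unique:
  assumes "weak_deriv_iter k f1 g1" "weak_deriv_iter k f2 g2" "AE x in unit_leb. f1 x = f2 x"
  shows "AE x in unit_leb. g1 x = g2 x"
  using assms
proof (induction k arbitrary: g1 g2)
  case (Suc k)
  then obtain h1 h2 where "weak_deriv_iter k f1 h1" "weak_deriv h1 g1" "weak_deriv_iter k f2 h2" "weak_deriv h2 g2"
    by auto
  then show ?case
    using Suc weak_deriv_AE_unique by blast
qed simp

lemma negligible_AE_unit_leb:
  assumes "AE x in unit_leb. P x"
  obtains N where "negligible N" "\<And>x. x \<in> {0..1} - N \<Longrightarrow> P x"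
proof -
  have "AE x in lebesgue. x \<in> {0..1} \<longrightarrow> P x"
    using assms by (subst (asm) AE_restrict_space_iff) auto
  then obtain N where "N \<in> null_sets lebesgue" "{x \<in> space lebesgue. \<not> (x \<in> {0..1} \<longrightarrow> P x)} \<subseteq> N"
    unfolding eventually_ae_filter by blast
  then show ?thesis
    by (intro that[of N]) (auto simp: negligible_iff_null_sets)
qed

lemma integral_AE_cong:
  assumes "AE x in unit_leb. f x = (g x :: real)" "0 \<le> a" "b \<le> 1"
  shows "integral {a..b} f = integral {a..b} g"
proof -
  obtain N where "negligible N" "\<And>x. x \<in> {0..1} - N \<Longrightarrow> f x = g x"
    using negligible_AE_unit_leb[OF assms(1)] by metis
  then show ?thesis
    using assms by (intro integral_spike[of N]) auto
qed

text \<open>Descent from the top: a continuous version of one derivative integrates to a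
  continuously differentiable version of the preceding one, by
  \<open>weak_deriv_AE_eq_integral\<close>.\<close>

lemma weak_deriv_iter_classical:
  assumes "weak_deriv_iter k f h" "AE x in unit_leb. h x = h' x" "continuous_on {0..1} h'"
  shows "\<exists>V. V k = h' \<and> (AE x in unit_leb. f x = V 0 x) \<and>
    (\<forall>j<k. \<forall>x\<in>{0..1}. (V j has_real_derivative V (Suc j) x) (at x within {0..1}))"
  using assms
proof (induction k arbitrary: h h')
  case 0
  then show ?case by (intro exI[of _ "\<lambda>_. h'"]) auto
next
  case (Suc k)
  from Suc.prems(1) obtain h1 where h1: "weak_deriv_iter k f h1" "weak_deriv h1 h"
    by auto
  obtain c where c: "AE x in unit_leb. h1 x = c + integral {0..x} h"
    using weak_deriv_AE_eq_integral[OF h1(2)] by blast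
  define h1' where "h1' x = c + integral {0..x} h'" for x
  have "AE x in unit_leb. x \<in> {0..1}"
    by (rule AE_I2) simp
  with c have "AE x in unit_leb. h1 x = h1' x"
    by eventually_elim (auto simp: h1'_def integral_AE_cong[OF Suc.prems(2)])
  moreover have D: "(h1' has_real_derivative h' x) (at x within {0..1})" if "x \<in> {0..1}" for x
    unfolding h1'_def using integral_has_real_derivative[OF Suc.prems(3) that]
    by (auto intro!: derivative_eq_intros)
  moreover have "continuous_on {0..1} h1'"
    by (rule DERIV_continuous_on[OF D])
  ultimately obtain V where V: "V k = h1'" "AE x in unit_leb. f x = V 0 x"
    "\<And>j x. j < k \<Longrightarrow> x \<in> {0..1} \<Longrightarrow> (V j has_real_derivative V (Suc j) x) (at x within {0..1})"
    using Suc.IH[OF h1(1)] by blast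
  show ?case
  proof (intro exI[of _ "V(Suc k := h')"] conjI allI impI ballI)
    fix j x assume j: "j < Suc k" and x: "x \<in> {0..1::real}"
    show "((V(Suc k := h')) j has_real_derivative (V(Suc k := h')) (Suc j) x) (at x within {0..1})"
    proof (cases "j = k")
      case True
      then show ?thesis using D[OF x] V(1) by simp
    next
      case False
      then show ?thesis using V(3)[of j x] j x by simp
    qed
  qed (use V in auto)
qed

section \<open>Uniform bounds and moduli\<close>

primrec fdiff :: "real \<Rightarrow> nat \<Rightarrow> (real \<Rightarrow> real) \<Rightarrow> real \<Rightarrow> real" where
  "fdiff h 0 f x = f x"
| "fdiff h (Suc j) f x = fdiff h j (\<lambda>y. f (y + h) - f y) x"

lemma fdiff_bound:
  assumes "\<And>i. i \<le> j \<Longrightarrow> \<bar>f (x + real i * h)\<bar> \<le> B"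
  shows "\<bar>fdiff h j f x\<bar> \<le> 2 ^ j * B"
  using assms
proof (induction j arbitrary: f B)
  case 0
  then show ?case using 0[of 0] by simp
next
  case (Suc j)
  have "\<bar>f (x + real i * h + h) - f (x + real i * h)\<bar> \<le> 2 * B" if "i \<le> j" for i
    using Suc.prems[of i] Suc.prems[of "Suc i"] that by (simp add: algebra_simps)
  then have "\<bar>fdiff h j (\<lambda>y. f (y + h) - f y) x\<bar> \<le> 2 ^ j * (2 * B)"
    by (rule Suc.IH)
  then show ?case by simp
qed

text \<open>Induction on the order, with the increments \<open>U i\<close> in place of
  \<open>V i\<close> on an interval shortened by \<open>h\<close>; the mean value theorem turns the
  last increment into the next derivative.\<close>

lemma fdiff_mvt:
  assumes "0 < h" "a \<le> x" "x + real j * h \<le> b"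
    and "\<And>i y. i < j \<Longrightarrow> y \<in> {a..b} \<Longrightarrow> (V i has_real_derivative V (Suc i) y) (at y within {a..b})"
  shows "\<exists>\<xi>\<in>{a..b}. fdiff h j (V 0) x = h ^ j * V j \<xi>"
  using assms
proof (induction j arbitrary: V b)
  case 0
  then show ?case by auto
next
  case (Suc j)
  define U where "U i y = V i (y + h) - V i y" for i y
  have "\<exists>\<xi>\<in>{a..b - h}. fdiff h j (U 0) x = h ^ j * U j \<xi>"
  proof (rule Suc.IH)
    show "x + real j * h \<le> b - h"
      using Suc.prems by (simp add: algebra_simps)
    fix i y assume i: "i < j" and y: "y \<in> {a..b - h}"
    have "(V i \<circ> (\<lambda>y. y + h) has_real_derivative V (Suc i) (y + h) * 1) (at y within {a..b - h})"
    proof (rule DERIV_image_chain)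
      show "(V i has_real_derivative V (Suc i) (y + h)) (at (y + h) within (\<lambda>y. y + h) ` {a..b - h})"
        using Suc.prems i y by (intro DERIV_subset[OF Suc.prems(4)]) auto
      show "((\<lambda>y. y + h) has_real_derivative 1) (at y within {a..b - h})"
        by (auto intro!: derivative_eq_intros)
    qed
    moreover have "(V i has_real_derivative V (Suc i) y) (at y within {a..b - h})"
      using Suc.prems i y by (intro DERIV_subset[OF Suc.prems(4)]) auto
    ultimately show "(U i has_real_derivative U (Suc i) y) (at y within {a..b - h})"
      unfolding U_def by (auto intro!: derivative_eq_intros simp: o_def)
  qed (use Suc.prems in auto)
  then obtain \<xi> where \<xi>: "\<xi> \<in> {a..b - h}" "fdiff h j (U 0) x = h ^ j * (V j (\<xi> + h) - V j \<xi>)"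
    unfolding U_def by auto
  have "\<exists>\<eta>\<in>{\<xi>..\<xi> + h}. V j (\<xi> + h) - V j \<xi> = V (Suc j) \<eta> * (\<xi> + h - \<xi>)"
  proof (rule mvt_very_simple)
    fix y assume "\<xi> \<le> y" "y \<le> \<xi> + h"
    then show "(V j has_derivative (*) (V (Suc j) y)) (at y within {\<xi>..\<xi> + h})"
      using \<xi>(1) unfolding has_field_derivative_def[symmetric]
      by (intro DERIV_subset[OF Suc.prems(4)]) auto
  qed (use Suc.prems in auto)
  then obtain \<eta> where "\<eta> \<in> {\<xi>..\<xi> + h}" "V j (\<xi> + h) - V j \<xi> = V (Suc j) \<eta> * h"
    by auto
  then show ?case
    using \<xi> by (intro bexI[of _ \<eta>]) (auto simp: U_def[abs_def])
qed

text \<open>The finite difference of order \<open>j\<close> bounds the \<open>j\<close>-th derivative at one point; the bound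
  spreads to the whole interval by integrating the next derivative.\<close>

lemma derivative_tower_bound:
  fixes m :: nat and B N :: real
  defines "R \<equiv> (2 * 2 ^ m) ^ m * B"
  assumes V: "\<And>i y. i < m \<Longrightarrow> y \<in> {0..1} \<Longrightarrow> (V i has_real_derivative V (Suc i) y) (at y within {0..1})"
    and B: "\<And>i. i \<le> m \<Longrightarrow> \<bar>V 0 (real i / 2 ^ m)\<bar> \<le> B"
    and N: "\<And>x y. x \<in> {0..1} \<Longrightarrow> y \<in> {0..1} \<Longrightarrow> \<bar>V m x - V m y\<bar> \<le> N"
    and j: "0 < j" "j \<le> m" and x: "x \<in> {0..1}"
  shows "\<bar>V j x\<bar> \<le> real m * R + N"
proof -
  have B0: "0 \<le> B" using B[of 0] by simp
  have N0: "0 \<le> N" using N[of 0 0] by simp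
  have R0: "0 \<le> R" using B0 by (simp add: R_def)
  have point: "\<exists>\<xi>\<in>{0..1}. \<bar>V j \<xi>\<bar> \<le> R" if j: "j \<le> m" for j
  proof -
    \<comment> \<open>All grid points of a difference of order \<open>j\<close> lie in the unit
      interval, because \<open>j \<le> m\<close> is below \<open>2 ^ m\<close>.\<close>
    let ?h = "1 / 2 ^ m :: real"
    have "j \<le> 2 ^ m"
      using j less_exp[of m] by linarith
    then have "real j * ?h \<le> 1"
      by simp
    then obtain \<xi> where \<xi>: "\<xi> \<in> {0..1}" "fdiff ?h j (V 0) 0 = ?h ^ j * V j \<xi>"
      using fdiff_mvt[of ?h 0 0 j 1 V] V j by auto
    have "\<bar>fdiff ?h j (V 0) 0\<bar> \<le> 2 ^ j * B"
      using B j by (intro fdiff_bound) auto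
    then have "\<bar>V j \<xi>\<bar> \<le> (2 * 2 ^ m) ^ j * B"
      unfolding \<xi>(2) by (simp add: abs_mult power_divide power_mult_distrib field_simps)
    also have "\<dots> \<le> R"
      unfolding R_def using j B0 by (intro mult_right_mono power_increasing) (auto simp: one_le_power order_trans[of 1 "2^m"])
    finally show ?thesis using \<xi>(1) by auto
  qed
  \<comment> \<open>The induction descends from order \<open>m\<close>, where the oscillation bound
    \<open>N\<close> takes the place of a bound on the next derivative; every level adds one
    \<open>R\<close>.\<close>
  have "\<bar>V (m - i) x\<bar> \<le> real (Suc i) * R + N" if "i < m" "x \<in> {0..1}" for i x
    using that
  proof (induction i arbitrary: x)
    case 0
    obtain \<xi> where "\<xi> \<in> {0..1}" "\<bar>V m \<xi>\<bar> \<le> R"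
      using point[of m] by auto
    then show ?case
      using N[of x \<xi>] 0 by auto
  next
    case (Suc i)
    obtain \<xi> where \<xi>: "\<xi> \<in> {0..1}" "\<bar>V (m - Suc i) \<xi>\<bar> \<le> R"
      using point[of "m - Suc i"] by auto
    have s: "Suc (m - Suc i) = m - i"
      using Suc.prems by simp
    have "norm (V (m - Suc i) x - V (m - Suc i) \<xi>) \<le> (real (Suc i) * R + N) * norm (x - \<xi>)"
    proof (rule field_differentiable_bound[of "{0..1}" _ "V (m - i)"])
      show "(V (m - Suc i) has_field_derivative V (m - i) z) (at z within {0..1})" if "z \<in> {0..1}" for z
        using V[of "m - Suc i" z] Suc.prems that s by simp
      show "norm (V (m - i) z) \<le> real (Suc i) * R + N" if "z \<in> {0..1}" for z
        using Suc.IH[of z] Suc.prems that by simp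
    qed (use \<xi> Suc.prems in auto)
    also have "\<dots> \<le> (real (Suc i) * R + N) * 1"
      using \<xi> Suc.prems R0 N0 by (intro mult_left_mono) auto
    finally show ?case
      using \<xi>(2) by (simp add: algebra_simps)
  qed
  from this[of "m - j" x] have "\<bar>V j x\<bar> \<le> real (Suc (m - j)) * R + N"
    using j x by simp
  also have "\<dots> \<le> real m * R + N"
    using j R0 by (intro add_right_mono mult_right_mono) auto
  finally show ?thesis .
qed

section \<open>Norms recovered from small shifts\<close>

lemma le_one_plus_powr: "y \<le> 1 + y powr p" if "0 \<le> y" "1 \<le> p" for y p :: real
proof (cases "y \<le> 1")
  case True
  then show ?thesis by (simp add: add_increasing2)
next
  case False
  then have "y powr 1 \<le> y powr p"
    using that by (intro powr_mono) auto
  then show ?thesis using False by simp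
qed

text \<open>In place of Hoelder's inequality, \<open>y \<le> 1 + y powr p\<close> suffices on a set
  of finite measure.\<close>

lemma Lp_fun_integrable:
  assumes "g \<in> Lp_fun p" "1 \<le> p"
  shows "integrable unit_leb g"
proof (rule Bochner_Integration.integrable_bound)
  show "integrable unit_leb (\<lambda>x. 1 + \<bar>g x\<bar> powr p)"
    using assms by (auto simp: Lp_fun_def intro!: Bochner_Integration.integrable_add continuous_imp_integrable_lebesgue_on)
  show "AE x in unit_leb. norm (g x) \<le> norm (1 + \<bar>g x\<bar> powr p)"
    using le_one_plus_powr[of "\<bar>g x\<bar>" p for x] assms by (auto intro!: AE_I2 simp: abs_of_nonneg add_nonneg_nonneg)
qed (use assms in \<open>auto simp: Lp_fun_def\<close>)

lemma zero_ext_eq: "zero_ext g x = indicator {0..1} x * g x"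
  by (simp add: zero_ext_def)

lemma abs_diff_powr_le:
  fixes a b p :: real
  assumes "0 \<le> p"
  shows "\<bar>a - b\<bar> powr p \<le> 2 powr p * (\<bar>a\<bar> powr p + \<bar>b\<bar> powr p)"
proof -
  have "\<bar>a - b\<bar> powr p \<le> (2 * max \<bar>a\<bar> \<bar>b\<bar>) powr p"
    using assms by (intro powr_mono2) auto
  also have "\<dots> = 2 powr p * max \<bar>a\<bar> \<bar>b\<bar> powr p"
    by (simp add: powr_mult)
  also have "\<dots> \<le> 2 powr p * (\<bar>a\<bar> powr p + \<bar>b\<bar> powr p)"
    by (intro mult_left_mono) (auto simp: max_def)
  finally show ?thesis .
qed

text \<open>Shifting by the total length of the interval separates the supports of \<open>g\<close> and its
  translate, so an increment bound for one small shift bounds the norm of \<open>g\<close>.\<close>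

lemma integral_abs_le_of_shift:
  assumes g: "g \<in> Lp_fun p" and p: "1 \<le> p"
    and shift: "Lp_norm p (\<lambda>x. zero_ext g x - zero_ext g (x + (1/2) ^ r)) < 1"
  shows "(LINT x|unit_leb. \<bar>g x\<bar>) \<le> 2 * 2 ^ r"
proof -
  define h :: real where "h = (1/2) ^ r"
  define G where "G = zero_ext g"
  define d where "d x = G x - G (x + h)" for x
  define D where "D x = \<bar>d x\<bar> powr p" for x
  have Gi: "integrable lebesgue G"
    using Lp_fun_integrable[OF g p] by (simp add: G_def zero_ext_eq[abs_def] integrable_restrict_space)
  have Gh: "integrable lebesgue (\<lambda>x. G (x + h))"
    using lebesgue_integrable_real_affine[OF Gi, of 1 h] by (simp add: add.commute)
  have Gp: "integrable lebesgue (\<lambda>x. \<bar>G x\<bar> powr p)"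
  proof -
    have "integrable lebesgue (\<lambda>x. indicator {0..1} x * \<bar>g x\<bar> powr p)"
      using g by (simp add: Lp_fun_def integrable_restrict_space)
    moreover have "(\<lambda>x. indicator {0..1} x * \<bar>g x\<bar> powr p) = (\<lambda>x. \<bar>G x\<bar> powr p)"
      using p by (auto simp: G_def zero_ext_def indicator_def)
    ultimately show ?thesis by simp
  qed
  have Gph: "integrable lebesgue (\<lambda>x. \<bar>G (x + h)\<bar> powr p)"
    using lebesgue_integrable_real_affine[OF Gp, of 1 h] by (simp add: add.commute)
  have [measurable]: "G \<in> borel_measurable lebesgue" "(\<lambda>x. G (x + h)) \<in> borel_measurable lebesgue"
    using Gi Gh by auto
  have Di: "integrable lebesgue D"
  proof (rule Bochner_Integration.integrable_bound)
    show "integrable lebesgue (\<lambda>x. 2 powr p * (\<bar>G x\<bar> powr p + \<bar>G (x + h)\<bar> powr p))"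
      using Gp Gph by simp
    show "D \<in> borel_measurable lebesgue"
      unfolding D_def d_def by measurable
    show "AE x in lebesgue. norm (D x) \<le> norm (2 powr p * (\<bar>G x\<bar> powr p + \<bar>G (x + h)\<bar> powr p))"
      using abs_diff_powr_le[of p] p by (auto intro!: AE_I2 simp: D_def d_def)
  qed
  have D1: "(LINT x|lebesgue. D x) \<le> 1"
  proof (rule ccontr)
    assume "\<not> (LINT x|lebesgue. D x) \<le> 1"
    then have "1 \<le> (LINT x|lebesgue. D x) powr (1 / p)"
      using p by (intro ge_one_powr_ge_zero) auto
    then show False
      using shift by (simp add: Lp_norm_def D_def d_def G_def h_def)
  qed
  have Dj: "integrable lebesgue (\<lambda>x. D (x + real j * h))" "(LINT x|lebesgue. D (x + real j * h)) = (LINT x|lebesgue. D x)" for j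
    using lebesgue_integrable_real_affine[OF Di, of 1 "real j * h"]
      lebesgue_integral_real_affine[of 1 D "real j * h"] by (simp_all add: add.commute)
  have tele: "(\<Sum>j<J. d (x + real j * h)) = G x - G (x + real J * h)" for x J
    by (induction J) (auto simp: d_def algebra_simps)
  have Jh: "real (2 ^ r) * h = 1"
    by (simp add: h_def power_one_over)
  \<comment> \<open>The sum telescopes to \<open>G x - G (x + 1)\<close>, and \<open>x + 1\<close>
    lies outside the interval unless \<open>x = 0\<close>. Each of the \<open>2 ^ r\<close> terms
    will have integral at most 2.\<close>
  have bound: "\<bar>G x\<bar> \<le> (\<Sum>j<2 ^ r. indicator {0..1} x + D (x + real j * h))" if "x \<noteq> 0" for x
  proof (cases "x \<in> {0..1}")
    case True
    then have "G (x + real (2 ^ r) * h) = 0"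
      unfolding Jh using that by (simp add: G_def zero_ext_def)
    then have "\<bar>G x\<bar> = \<bar>\<Sum>j<2 ^ r. d (x + real j * h)\<bar>"
      by (simp add: tele)
    also have "\<dots> \<le> (\<Sum>j<2 ^ r. \<bar>d (x + real j * h)\<bar>)"
      by (rule sum_abs)
    also have "\<dots> \<le> (\<Sum>j<2 ^ r. indicator {0..1} x + D (x + real j * h))"
      using True p le_one_plus_powr by (intro sum_mono) (auto simp: D_def)
    finally show ?thesis .
  next
    case False
    then show ?thesis
      by (auto simp: G_def zero_ext_def D_def intro!: sum_nonneg)
  qed
  have ind: "integrable lebesgue (indicator {0..1} :: real \<Rightarrow> real)"
    by (rule integrable_real_indicator) auto
  have "(LINT x|unit_leb. \<bar>g x\<bar>) = (LINT x|lebesgue. \<bar>G x\<bar>)"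
    by (auto simp: integral_restrict_space G_def zero_ext_eq abs_mult intro!: Bochner_Integration.integral_cong)
  also have "\<dots> \<le> (LINT x|lebesgue. (\<Sum>j<2 ^ r. indicator {0..1} x + D (x + real j * h)))"
  proof (rule integral_mono_AE)
    have "AE x in lebesgue. x \<notin> {0::real}"
      by (rule AE_not_in) (simp add: negligible_iff_null_sets[symmetric])
    then show "AE x in lebesgue. \<bar>G x\<bar> \<le> (\<Sum>j<2 ^ r. indicator {0..1} x + D (x + real j * h))"
      by (rule eventually_mono) (use bound in auto)
  qed (use Gi Dj(1) ind in auto)
  also have "\<dots> = (\<Sum>j<(2::nat) ^ r. 1 + (LINT x|lebesgue. D x))"
    using Dj ind by (subst Bochner_Integration.integral_sum) auto
  also have "\<dots> \<le> (\<Sum>j<(2::nat) ^ r. 2)"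
    using D1 by (intro sum_mono) auto
  finally show ?thesis
    by simp
qed

section \<open>Translates of functions with integrable derivative\<close>

lemma integral_shift_diff_le:
  fixes A :: "real \<Rightarrow> real"
  assumes A: "continuous_on {0..1} A" "mono_on {0..1} A" "A 0 = 0" and h: "0 \<le> h" "h \<le> 1"
  shows "integral {0..1 - h} (\<lambda>x. A (x + h) - A x) \<le> h * A 1"
proof -
  have A0: "0 \<le> A x" "A x \<le> A 1" if "x \<in> {0..1}" for x
    using mono_onD[OF A(2), of 0 x] mono_onD[OF A(2), of x 1] A(3) that by auto
  have Ai: "A integrable_on {a..b}" if "0 \<le> a" "b \<le> 1" for a b
    using that by (intro integrable_continuous_real continuous_on_subset[OF A(1)]) auto
  have sh: "integral {0..1 - h} (\<lambda>x. A (x + h)) = integral {h..1} A"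
    using integral_shift[of 0 h "1 - h" A] continuous_on_subset[OF A(1), of "{h..1}"] h by (simp add: o_def)
  have shc: "(\<lambda>x. A (x + h)) integrable_on {0..1 - h}"
    using h by (intro integrable_continuous_real continuous_on_compose2[OF A(1)] continuous_intros) auto
  have "integral {0..1 - h} (\<lambda>x. A (x + h) - A x) = integral {h..1} A - integral {0..1 - h} A"
    using h Ai[of 0 "1 - h"] shc by (simp add: sh Henstock_Kurzweil_Integration.integral_diff)
  \<comment> \<open>Both integrals are completed to the unit interval, so that only the end strips
    of width \<open>h\<close> remain: the left one is nonnegative, the right one at most
    \<open>h * A 1\<close>.\<close>
  also have "\<dots> = integral {1 - h..1} A - integral {0..h} A"
    using Henstock_Kurzweil_Integration.integral_combine[of 0 h 1 A]
      Henstock_Kurzweil_Integration.integral_combine[of 0 "1 - h" 1 A] Ai[of 0 1] h by simp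
  also have "\<dots> \<le> integral {1 - h..1} A"
  proof -
    have "0 \<le> integral {0..h} A"
      using A0 h Ai by (intro Henstock_Kurzweil_Integration.integral_nonneg) auto
    then show ?thesis by simp
  qed
  also have "\<dots> \<le> integral {1 - h..1} (\<lambda>x. A 1)"
    using A0 h Ai by (intro integral_le) auto
  also have "\<dots> = h * A 1"
    using h by simp
  finally show ?thesis .
qed

text \<open>The interior increments are bounded by \<open>K\<close> and, in the mean, by \<open>h\<close> times the norm of
  the derivative; the cut-offs at the two end points contribute \<open>h * K powr p\<close> each.\<close>

lemma shift_integral_le_nonneg:
  fixes f V v :: "real \<Rightarrow> real"
  assumes p: "1 \<le> p" and fV: "AE x in unit_leb. f x = V x"
    and v: "v absolutely_integrable_on {0..1}" "integral {0..1} (\<lambda>t. \<bar>v t\<bar>) \<le> K"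
    and V: "\<And>x y. 0 \<le> x \<Longrightarrow> x \<le> y \<Longrightarrow> y \<le> 1 \<Longrightarrow> V y - V x = integral {x..y} v"
    and K: "0 < K" "\<And>x. x \<in> {0..1} \<Longrightarrow> \<bar>V x\<bar> \<le> K / 2"
    and h: "0 \<le> h" "h \<le> 1"
  shows "(LINT x|lebesgue. \<bar>zero_ext f x - zero_ext f (x + h)\<bar> powr p) \<le> 3 * h * K powr p"
proof -
  define A where "A x = integral {0..x} (\<lambda>t. \<bar>v t\<bar>)" for x
  have vi: "v integrable_on {0..1}" and ai: "(\<lambda>t. \<bar>v t\<bar>) integrable_on {0..1}"
    using v by (auto simp: absolutely_integrable_on_def)
  have Ac: "continuous_on {0..1} A"
    unfolding A_def by (intro indefinite_integral_continuous_1 ai)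
  have Ad: "A y - A x = integral {x..y} (\<lambda>t. \<bar>v t\<bar>)" if "0 \<le> x" "x \<le> y" "y \<le> 1" for x y
    unfolding A_def using that Henstock_Kurzweil_Integration.integral_combine[of 0 x y "\<lambda>t. \<bar>v t\<bar>"]
      integrable_on_subinterval[OF ai, of 0 y] by simp
  have Am: "mono_on {0..1} A"
  proof (rule mono_onI)
    fix x y :: real assume "x \<in> {0..1}" "y \<in> {0..1}" "x \<le> y"
    moreover from this have "0 \<le> integral {x..y} (\<lambda>t. \<bar>v t\<bar>)"
      by (intro Henstock_Kurzweil_Integration.integral_nonneg integrable_on_subinterval[OF ai]) auto
    ultimately show "A x \<le> A y"
      using Ad[of x y] by simp
  qed
  have VA: "\<bar>V y - V x\<bar> \<le> A y - A x" if xy: "0 \<le> x" "x \<le> y" "y \<le> 1" for x y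
    using integral_norm_bound_integral[of v "{x..y}" "\<lambda>t. \<bar>v t\<bar>"] xy V[OF xy] Ad[OF xy]
      integrable_on_subinterval[OF vi, of x y] integrable_on_subinterval[OF ai, of x y] by auto
  define E where "E x = indicator {0..1 - h} x * (A (x + h) - A x)" for x
  define Bd where "Bd x = K powr p * (indicator {-h..0} x + indicator {1 - h..1} x) + K powr (p - 1) * E x" for x
  have Ehk: "(\<lambda>x. A (x + h) - A x) absolutely_integrable_on {0..1 - h}"
    using h by (intro absolutely_integrable_continuous_real continuous_intros continuous_on_compose2[OF Ac]) auto
  then have Ei: "integrable lebesgue E"
    by (simp add: set_integrable_def E_def[abs_def])
  have "(LINT x|lebesgue. E x) = integral {0..1 - h} (\<lambda>x. A (x + h) - A x)"
    using set_lebesgue_integral_eq_integral(2)[OF Ehk] by (simp add: set_lebesgue_integral_def E_def)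
  also have "\<dots> \<le> h * A 1"
    using h by (intro integral_shift_diff_le Ac Am) (auto simp: A_def)
  also have "\<dots> \<le> h * K"
    using v(2) h by (intro mult_left_mono) (auto simp: A_def)
  finally have EI: "(LINT x|lebesgue. E x) \<le> h * K" .
  have E0: "0 \<le> E x" for x
    using mono_onD[OF Am, of x "x + h"] h by (auto simp: E_def indicator_def)
  have ind: "integrable lebesgue (indicator {a..b} :: real \<Rightarrow> real)" for a b :: real
    by (rule integrable_real_indicator) (auto simp: emeasure_lborel_Icc_eq)
  have Bi: "integrable lebesgue Bd"
    unfolding Bd_def using ind Ei by auto
  have BdI: "(LINT x|lebesgue. Bd x) \<le> 3 * h * K powr p"
  proof -
    have "(LINT x|lebesgue. Bd x) = K powr p * (h + h) + K powr (p - 1) * (LINT x|lebesgue. E x)"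
      unfolding Bd_def using ind Ei h by simp
    also have "\<dots> \<le> K powr p * (h + h) + K powr (p - 1) * (h * K)"
      using EI by (intro add_left_mono mult_left_mono) auto
    also have "K powr (p - 1) * (h * K) = h * K powr p"
      using K(1) powr_add[of K "p - 1" 1] by simp
    finally show ?thesis by (simp add: algebra_simps)
  qed
  obtain N where N: "negligible N" "\<And>x. x \<in> {0..1} - N \<Longrightarrow> f x = V x"
    using negligible_AE_unit_leb[OF fV] by metis
  \<comment> \<open>The translate of the exceptional set is removed too, since \<open>f\<close> is
    also evaluated at \<open>x + h\<close>.\<close>
  have "AE x in lebesgue. x \<notin> N \<union> (+) (- h) ` N"
    using N(1) negligible_translation[OF N(1), of "- h"]
    by (intro AE_not_in) (simp add: negligible_iff_null_sets[symmetric])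
  then have "AE x in lebesgue. \<bar>zero_ext f x - zero_ext f (x + h)\<bar> powr p \<le> Bd x"
  proof (rule eventually_mono)
    fix x assume "x \<notin> N \<union> (+) (- h) ` N"
    then have "x \<notin> N" "x + h \<notin> N"
      by (auto simp: image_iff)
    then have ext: "zero_ext f x = zero_ext V x" "zero_ext f (x + h) = zero_ext V (x + h)"
      using N(2) by (auto simp: zero_ext_def)
    have half: "\<bar>zero_ext V y\<bar> \<le> K / 2" for y
      using K by (auto simp: zero_ext_def)
    let ?d = "\<bar>zero_ext f x - zero_ext f (x + h)\<bar>"
    have dK: "?d \<le> K"
      unfolding ext using half[of x] half[of "x + h"] by linarith
    consider "x \<in> {-h..0} \<or> x \<in> {1 - h..1}" | "x < - h \<or> 1 < x" | "0 < x" "x < 1 - h"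
      using h by force
    then show "?d powr p \<le> Bd x"
    proof cases
      case 1
      have "?d powr p \<le> K powr p"
        using dK p by (intro powr_mono2) auto
      also have "\<dots> \<le> K powr p * (indicator {-h..0} x + indicator {1 - h..1} x)"
        using 1 by (auto simp: indicator_def)
      also have "\<dots> \<le> Bd x"
        using E0 by (simp add: Bd_def)
      finally show ?thesis .
    next
      case 2
      then have "?d = 0"
        using h by (auto simp: zero_ext_def)
      then show ?thesis
        using E0 by (simp add: Bd_def)
    next
      case 3
      \<comment> \<open>One factor is kept as an increment, to be integrated; the power
        \<open>p - 1\<close> is bounded by that of \<open>K\<close>.\<close>
      have "?d powr p = ?d powr (p - 1) * ?d"
        using powr_add[of ?d "p - 1" 1] by simp
      also have "\<dots> \<le> K powr (p - 1) * (A (x + h) - A x)"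
        using dK p VA[of x "x + h"] 3 h unfolding ext
        by (intro mult_mono powr_mono2) (auto simp: zero_ext_def abs_minus_commute)
      also have "\<dots> = K powr (p - 1) * E x"
        using 3 by (simp add: E_def)
      also have "\<dots> \<le> Bd x"
        by (simp add: Bd_def)
      finally show ?thesis .
    qed
  qed
  then have "(LINT x|lebesgue. \<bar>zero_ext f x - zero_ext f (x + h)\<bar> powr p) \<le> (LINT x|lebesgue. Bd x)"
    using E0 by (intro integral_mono_AE' Bi) (auto intro!: AE_I2 add_nonneg_nonneg simp: Bd_def)
  then show ?thesis
    using BdI by linarith
qed

lemma shift_integral_le:
  fixes f V v :: "real \<Rightarrow> real"
  assumes "1 \<le> p" "AE x in unit_leb. f x = V x"
    and "v absolutely_integrable_on {0..1}" "integral {0..1} (\<lambda>t. \<bar>v t\<bar>) \<le> K"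
    and "\<And>x y. 0 \<le> x \<Longrightarrow> x \<le> y \<Longrightarrow> y \<le> 1 \<Longrightarrow> V y - V x = integral {x..y} v"
    and "0 < K" "\<And>x. x \<in> {0..1} \<Longrightarrow> \<bar>V x\<bar> \<le> K / 2"
    and h: "\<bar>h\<bar> \<le> 1"
  shows "(LINT x|lebesgue. \<bar>zero_ext f x - zero_ext f (x + h)\<bar> powr p) \<le> 3 * \<bar>h\<bar> * K powr p"
proof (cases "0 \<le> h")
  case True
  then show ?thesis
    using shift_integral_le_nonneg[OF assms(1-7), of h] h by auto
next
  case False
  have "(LINT x|lebesgue. \<bar>zero_ext f x - zero_ext f (x + h)\<bar> powr p)
      = (LINT x|lebesgue. \<bar>zero_ext f x - zero_ext f (x + (- h))\<bar> powr p)"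
    by (subst lebesgue_integral_real_affine[of 1 _ "- h"]) (simp_all add: abs_minus_commute add.commute)
  then show ?thesis
    using shift_integral_le_nonneg[OF assms(1-7), of "- h"] h False by auto
qed

text \<open>The tower of derivatives starts one level below \<open>f\<close>, at its primitive
  \<open>U 0\<close>: the values on the grid that \<open>derivative_tower_bound\<close> asks for are
  then integrals of \<open>f\<close>, which a name supplies. The top level \<open>U m\<close> is the
  derivative of order \<open>m - 1\<close>, whose oscillation is bounded by the integral of
  \<open>\<bar>g x\<bar>\<close>.\<close>

lemma sobolev_shift_integral_le:
  fixes f g :: "real \<Rightarrow> real" and B K :: real
  assumes p: "1 \<le> p" and m: "1 \<le> m" and fg: "weak_deriv_iter m f g"
    and g: "(LINT x|unit_leb. \<bar>g x\<bar>) \<le> N"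
    and B: "\<And>i. i \<le> m \<Longrightarrow> \<bar>integral {0..real i / 2 ^ m} f\<bar> \<le> B"
    and K: "0 < K" "2 * (real m * ((2 * 2 ^ m) ^ m * B) + N) \<le> K"
    and h: "\<bar>h\<bar> \<le> 1"
  shows "(LINT x|lebesgue. \<bar>zero_ext f x - zero_ext f (x + h)\<bar> powr p) \<le> 3 * \<bar>h\<bar> * K powr p"
proof -
  obtain k where k: "m = Suc k"
    using m by (cases m) auto
  obtain w where w: "weak_deriv_iter k f w" "weak_deriv w g"
    using fg by (auto simp: k)
  have gi: "integrable unit_leb g"
    using weak_deriv_integrable[OF w(2)] by auto
  then have ga: "g absolutely_integrable_on {0..1}"
    by (simp add: integrable_lebesgue_on_iff_absolutely)
  then have gik: "g integrable_on {0..1}" "(\<lambda>x. \<bar>g x\<bar>) integrable_on {0..1}"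
    by (auto simp: absolutely_integrable_on_def)
  have gN: "integral {0..1} (\<lambda>x. \<bar>g x\<bar>) \<le> N"
    using g gi by (simp add: lebesgue_integral_eq_integral)
  obtain c where c: "AE x in unit_leb. w x = c + integral {0..x} g"
    using weak_deriv_AE_eq_integral[OF w(2)] by blast
  have "continuous_on {0..1} (\<lambda>x. c + integral {0..x} g)"
    by (intro continuous_intros indefinite_integral_continuous_1 gik)
  then obtain V where V: "V k = (\<lambda>x. c + integral {0..x} g)" "AE x in unit_leb. f x = V 0 x"
    "\<And>j x. j < k \<Longrightarrow> x \<in> {0..1} \<Longrightarrow> (V j has_real_derivative V (Suc j) x) (at x within {0..1})"
    using weak_deriv_iter_classical[OF w(1) c] by blast
  have Vc: "continuous_on {0..1} (V j)" if "j \<le> k" for j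
  proof (cases "j = k")
    case True
    then show ?thesis
      unfolding V(1) True by (intro continuous_intros indefinite_integral_continuous_1 gik)
  next
    case False
    then show ?thesis
      using that by (intro DERIV_continuous_on[OF V(3)]) auto
  qed
  have inc: "V k y - V k x = integral {x..y} g" if "0 \<le> x" "x \<le> y" "y \<le> 1" for x y
    unfolding V(1) using that Henstock_Kurzweil_Integration.integral_combine[of 0 x y g]
      integrable_on_subinterval[OF gik(1), of 0 y] by simp
  have osc: "\<bar>V k y - V k x\<bar> \<le> N" if xy: "0 \<le> x" "x \<le> y" "y \<le> 1" for x y
  proof -
    have "\<bar>integral {x..y} g\<bar> \<le> integral {x..y} (\<lambda>x. \<bar>g x\<bar>)"
      using integral_norm_bound_integral[of g "{x..y}" "\<lambda>t. \<bar>g t\<bar>"] xy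
        integrable_on_subinterval[OF gik(1), of x y] integrable_on_subinterval[OF gik(2), of x y] by auto
    also have "\<dots> \<le> integral {0..1} (\<lambda>x. \<bar>g x\<bar>)"
      using xy by (intro integral_subset_le gik integrable_on_subinterval[OF gik(2)]) auto
    finally show ?thesis
      using gN inc[OF xy] by simp
  qed
  define U where "U j = (case j of 0 \<Rightarrow> (\<lambda>x. integral {0..x} (V 0)) | Suc i \<Rightarrow> V i)" for j
  define S where "S = real m * ((2 * 2 ^ m) ^ m * B) + N"
  have US: "\<bar>U j x\<bar> \<le> S" if j: "0 < j" "j \<le> m" and x: "x \<in> {0..1}" for j x
    unfolding S_def
  proof (rule derivative_tower_bound[where V = U, OF _ _ _ j x])
    fix i y assume i: "i < m" and y: "y \<in> {0..1::real}"
    show "(U i has_real_derivative U (Suc i) y) (at y within {0..1})"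
      using V(3)[of "i - 1" y] i y integral_has_real_derivative[OF Vc[of 0] y]
      by (cases i) (auto simp: U_def k)
  next
    fix i assume "i \<le> m"
    then have "i \<le> 2 ^ m"
      using less_exp[of m] by linarith
    then have "real i / 2 ^ m \<le> 1"
      by simp
    then show "\<bar>U 0 (real i / 2 ^ m)\<bar> \<le> B"
      using B[OF \<open>i \<le> m\<close>] integral_AE_cong[OF V(2), of 0] by (simp add: U_def)
  next
    fix x y :: real assume "x \<in> {0..1}" "y \<in> {0..1}"
    then show "\<bar>U m x - U m y\<bar> \<le> N"
      using osc[of x y] osc[of y x] by (cases "x \<le> y") (auto simp: U_def k abs_minus_commute)
  qed
  have N0: "0 \<le> N"
    using osc[of 0 0] by simp
  have B0: "0 \<le> B"
    using B[of 0] by simp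
  have SK: "S \<le> K / 2" and S0: "0 \<le> S" and NS: "N \<le> S"
    using K B0 N0 by (auto simp: S_def)
  have V0: "\<bar>V 0 x\<bar> \<le> K / 2" if "x \<in> {0..1}" for x
    using US[of 1 x] that SK by (simp add: U_def k)
  \<comment> \<open>For \<open>m = 1\<close> the derivative of \<open>f\<close> is \<open>g\<close>,
    which is controlled in the mean only; for larger \<open>m\<close> it has a continuous version
    bounded by \<open>S\<close>.\<close>
  show ?thesis
  proof (cases k)
    case 0
    have "integral {0..1} (\<lambda>t. \<bar>g t\<bar>) \<le> K"
      using gN NS SK K(1) by linarith
    then show ?thesis
      using inc by (intro shift_integral_le[OF p V(2) ga _ _ K(1) V0 h]) (auto simp: 0)
  next
    case (Suc i)
    have V1c: "continuous_on {0..1} (V 1)"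
      using Vc[of 1] Suc by simp
    have "integral {0..1} (\<lambda>t. \<bar>V 1 t\<bar>) \<le> integral {0..1::real} (\<lambda>t. S)"
    proof (rule Henstock_Kurzweil_Integration.integral_le)
      show "(\<lambda>t. \<bar>V 1 t\<bar>) integrable_on {0..1}"
        by (intro integrable_continuous_real continuous_intros V1c)
      show "\<bar>V 1 t\<bar> \<le> S" if "t \<in> {0..1}" for t
        using US[of 2 t] that by (simp add: U_def k Suc numeral_2_eq_2)
    qed auto
    then have "integral {0..1} (\<lambda>t. \<bar>V 1 t\<bar>) \<le> K"
      using SK K(1) by simp
    moreover have "V 0 y - V 0 x = integral {x..y} (V 1)" if "0 \<le> x" "x \<le> y" "y \<le> 1" for x y
    proof -
      have "(V 1 has_integral V 0 y - V 0 x) {x..y}"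
        using that Suc by (intro fundamental_theorem_of_calculus)
          (auto simp: has_real_derivative_iff_has_vector_derivative[symmetric]
            intro!: DERIV_subset[OF V(3)[of 0, simplified]])
      then show ?thesis by (simp add: integral_unique)
    qed
    ultimately show ?thesis
      by (intro shift_integral_le[OF p V(2) absolutely_integrable_continuous_real[OF V1c] _ _ K(1) V0 h]) auto
  qed
qed

text \<open>In the exponent, \<open>q * e\<close> cancels the constant, \<open>q * n\<close> yields
  \<open>(1/2) ^ n\<close> after taking the root, and the summand 2 turns the factor 3 into
  \<open>3 / 4\<close>, whence the strict inequality.\<close>

lemma Lp_norm_less_of_integral:
  assumes p: "1 \<le> p" "p \<le> real q" and h: "\<bar>h\<bar> \<le> (1/2) ^ \<mu>" and \<mu>: "q * (n + e) + 2 \<le> \<mu>"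
    and I: "(LINT x|lebesgue. \<bar>d x\<bar> powr p) \<le> 3 * \<bar>h\<bar> * (2 ^ e) powr p"
  shows "Lp_norm p d < (1/2) ^ n"
proof -
  let ?I = "LINT x|lebesgue. \<bar>d x\<bar> powr p"
  have I0: "0 \<le> ?I"
    by (rule Bochner_Integration.integral_nonneg) simp
  have "(2 ^ e) powr p = (2::real) powr (real e * p)"
    by (simp add: powr_realpow[symmetric] powr_powr)
  also have "\<dots> \<le> 2 powr (real e * real q)"
    using p by (intro powr_mono mult_left_mono) auto
  also have "\<dots> = 2 ^ (q * e)"
    by (simp add: powr_realpow[symmetric] mult.commute)
  finally have e: "(2 ^ e) powr p \<le> (2::real) ^ (q * e)" .
  have "\<bar>h\<bar> \<le> (1/2) ^ (q * (n + e) + 2)"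
    using h power_decreasing[OF \<mu>, of "1/2 :: real"] by simp
  with e have "?I \<le> 3 * (1/2) ^ (q * (n + e) + 2) * 2 ^ (q * e)"
    by (intro order_trans[OF I] mult_mono) auto
  also have "\<dots> = 3 / 4 * (1/2) ^ (q * n)"
    by (simp add: power_add algebra_simps power_one_over)
  also have "\<dots> < (1/2) ^ (q * n)"
    by simp
  also have "\<dots> = (1/2) powr (real n * real q)"
    by (simp add: powr_realpow[symmetric] mult.commute)
  also have "\<dots> \<le> (1/2) powr (real n * p)"
    using p by (intro powr_mono') (auto intro: mult_left_mono)
  finally have "?I powr (1 / p) < ((1/2) powr (real n * p)) powr (1 / p)"
    using I0 p by (intro powr_less_mono2) auto
  also have "\<dots> = (1/2) ^ n"
    using p by (simp add: powr_powr powr_realpow)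
  finally show ?thesis
    by (simp add: Lp_norm_def)
qed

section \<open>Codes of dyadic rationals\<close>

definition digit_sum :: "int \<Rightarrow> bits \<Rightarrow> real" where
  "digit_sum k ds = (\<Sum>i < length ds. of_bool (ds ! i) * 2 powi (k - 1 - int i))"

lemma digit_sum_Nil [simp]: "digit_sum k [] = 0"
  by (simp add: digit_sum_def)

lemma digit_sum_snoc: "digit_sum k (ds @ [b]) = digit_sum k ds + of_bool b * 2 powi (k - 1 - int (length ds))"
  by (simp add: digit_sum_def nth_append)

lemma digit_sum_append_zeros: "digit_sum k (ds @ replicate n False) = digit_sum k ds"
proof (induction n)
  case (Suc n)
  have "ds @ replicate (Suc n) False = (ds @ replicate n False) @ [False]"
    by (simp add: replicate_append_same)
  then show ?case
    using Suc by (simp only: digit_sum_snoc) simp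
qed simp

text \<open>Subtracting one unit of the last place is what makes the induction over the digits
  work.\<close>

lemma digit_sum_bounds: "0 \<le> digit_sum k ds \<and> digit_sum k ds \<le> 2 powi k - 2 powi (k - int (length ds))"
proof (induction ds rule: rev_induct)
  case (snoc b ds)
  define t where "t = (2::real) powi (k - 1 - int (length ds))"
  have t: "0 < t"
    by (simp add: t_def)
  have "(2::real) powi (k - int (length ds)) = 2 * t"
    using power_int_add_1'[of "2::real" "k - 1 - int (length ds)"] by (simp add: t_def algebra_simps)
  moreover have e: "k - int (length (ds @ [b])) = k - 1 - int (length ds)"
    by simp
  ultimately show ?case
    unfolding digit_sum_snoc e t_def[symmetric] using snoc t by auto
qed simp

lemma ex_digit_sum:
  assumes "i < 2 ^ n"
  shows "\<exists>ds. length ds = n \<and> digit_sum k ds = real i * 2 powi (k - int n)"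
  using assms
proof (induction n arbitrary: i)
  case (Suc n)
  have "i div 2 < 2 ^ n"
    using Suc.prems by (simp add: less_mult_imp_div_less mult.commute)
  then obtain ds where ds: "length ds = n" "digit_sum k ds = real (i div 2) * 2 powi (k - int n)"
    using Suc.IH[of "i div 2"] by auto
  have "(2::real) powi (k - int n) = 2 * 2 powi (k - int (Suc n))"
    using power_int_add_1'[of "2::real" "k - int (Suc n)"] by (simp add: algebra_simps)
  moreover have "real i = 2 * real (i div 2) + of_bool (odd i)"
    by (cases "even i") (auto elim!: evenE oddE)
  ultimately have "digit_sum k (ds @ [odd i]) = real i * 2 powi (k - int (Suc n))"
    using ds by (simp add: digit_sum_snoc algebra_simps)
  then show ?case
    using ds(1) by (intro exI[of _ "ds @ [odd i]"]) simp
qed auto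

lemma dyadic_Cons:
  "dyadic (s # u) = (if s then - 1 else 1) *
    digit_sum (int (length (takeWhile (\<lambda>x. x) u))) (tl (dropWhile (\<lambda>x. x) u))"
  by (simp add: digit_sum_def Let_def)

declare dyadic.simps(2) [simp del]

text \<open>The number of digits before the point is written in unary, so it cannot exceed the
  length of the code. In this way the size of a name bounds the integrals that it
  approximates.\<close>

lemma abs_dyadic_le: "\<bar>dyadic w\<bar> \<le> 2 ^ length w"
proof (cases w)
  case (Cons s u)
  let ?k = "length (takeWhile (\<lambda>x. x) u)"
  let ?d = "digit_sum (int ?k) (tl (dropWhile (\<lambda>x. x) u))"
  have "0 \<le> ?d" "?d \<le> 2 ^ ?k"
    using digit_sum_bounds[of "int ?k" "tl (dropWhile (\<lambda>x. x) u)"]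
    by (auto intro: order_trans simp: power_int_of_nat)
  then have "\<bar>dyadic w\<bar> \<le> 2 ^ ?k"
    by (auto simp: Cons dyadic_Cons)
  also have "\<dots> \<le> 2 ^ length w"
    using length_takeWhile_le[of "\<lambda>x. x" u] by (intro power_increasing) (auto simp: Cons le_Suc_eq)
  finally show ?thesis .
qed simp

lemma digit_sum_zeros: "digit_sum k (replicate n False) = 0"
  using digit_sum_append_zeros[of k "[]" n] by simp

text \<open>Behind a terminated unary prefix the zeros are digits. If the prefix is not terminated,
  there are no digits and the value is 0; the first zero then ends the prefix and the others are
  digits again. For the empty code the first zero is the sign.\<close>

lemma dyadic_append_zeros: "dyadic (w @ replicate n False) = dyadic w"
proof (cases w)
  case Nil
  then show ?thesis
  proof (cases n)
    case (Suc n')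
    then show ?thesis
      using Nil by (cases n') (auto simp: dyadic_Cons digit_sum_zeros)
  qed simp
next
  case (Cons s u)
  show ?thesis
  proof (cases "\<exists>x\<in>set u. \<not> x")
    case True
    then obtain x where x: "x \<in> set u" "\<not> x" by blast
    then have "dropWhile (\<lambda>x. x) u \<noteq> []"
      by (auto simp: dropWhile_eq_Nil_conv)
    then have "tl (dropWhile (\<lambda>x. x) (u @ replicate n False)) = tl (dropWhile (\<lambda>x. x) u) @ replicate n False"
      using x by (subst dropWhile_append1) auto
    moreover have "takeWhile (\<lambda>x. x) (u @ replicate n False) = takeWhile (\<lambda>x. x) u"
      using x by (subst takeWhile_append1) auto
    ultimately show ?thesis
      by (simp add: Cons dyadic_Cons digit_sum_append_zeros)
  next
    case False
    then have d: "dropWhile (\<lambda>x. x) u = []"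
      by (auto simp: dropWhile_eq_Nil_conv)
    have "tl (dropWhile (\<lambda>x. x) u) = []"
      by (simp only: d list.sel(2))
    moreover have "dropWhile (\<lambda>x. x) (u @ replicate n False) = replicate n False"
      using False by (subst dropWhile_append2) (auto simp: dropWhile_eq_self_iff)
    ultimately show ?thesis
      by (cases n) (simp_all add: Cons dyadic_Cons digit_sum_zeros)
  qed
qed

lemma ex_dyadic:
  assumes "i \<le> 2 ^ m"
  shows "\<exists>b. dyadic b = real i / 2 ^ m"
proof -
  \<comment> \<open>One digit before the point is needed because \<open>i = 2 ^ m\<close> denotes 1;
    \<open>m\<close> digits follow it.\<close>
  have "i < 2 ^ Suc m"
    using assms by (simp add: le_less_trans)
  then obtain ds where "digit_sum 1 ds = real i * 2 powi (1 - int (Suc m))"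
    using ex_digit_sum by blast
  then have "dyadic (False # True # False # ds) = real i / 2 ^ m"
    by (simp add: dyadic_Cons power_int_minus field_simps)
  then show ?thesis ..
qed

section \<open>The padding machine\<close>

definition cells :: "bits \<Rightarrow> int \<Rightarrow> bool option" where
  "cells w = fst (string_tape w)"

lemma cells_eq: "cells w i = (if 0 \<le> i \<and> i < int (length w) then Some (w ! nat i) else None)"
  by (simp add: cells_def string_tape_def)

lemma string_tape_cells: "string_tape w = (cells w, 0)"
  by (simp add: cells_def string_tape_def)

lemma cells_snoc: "(cells w)(int (length w) := Some b) = cells (w @ [b])"
  by (rule ext) (auto simp: cells_eq nth_append)

lemma tape_string_cells: "tape_string (cells w, h) = w"
proof -
  have "(LEAST n. cells w (int n) = None) = length w"
    by (rule Least_equality) (auto simp: cells_eq not_less split: if_splits)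
  then show ?thesis
    by (auto simp: tape_string_def cells_eq intro!: nth_equalityI)
qed

text \<open>The machine copies the oracle's answer on its input \<open>a\<close> to the output tape, queries
  \<open>a1\<^sup>c\<close>, and then appends \<open>c\<close> zeros for every step of a sweep over the second answer and the
  input, which runs until both are exhausted. A mark on tape 4 tells the two answers apart. States
  \<open>4\<close> to \<open>3 + c\<close> append \<open>c\<close> zeros to the output and, as a side effect, \<open>c\<close> ones to the query.\<close>

definition pad_trans :: "nat \<Rightarrow> nat \<Rightarrow> bool option list \<Rightarrow> nat \<times> (bool option \<times> direction) list" where
  "pad_trans c q s =
    (if q = 0 then
       (case s ! 3 of
          Some b \<Rightarrow> (0, [(Some b, Rgt), (s ! 1, Stay), (s ! 2, Stay), (s ! 3, Rgt), (s ! 4, Stay)])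
        | None \<Rightarrow> (2, map (\<lambda>i. (s ! i, Stay)) [0, 1, 2, 3, 4]))
     else if q = 3 then
       (if s ! 4 = None then
          (case s ! 1 of
             Some b \<Rightarrow> (3, [(s ! 0, Stay), (s ! 1, Rgt), (Some b, Rgt), (s ! 3, Stay), (s ! 4, Stay)])
           | None \<Rightarrow> (4, map (\<lambda>i. (s ! i, Stay)) [0, 1, 2, 3, 4]))
        else
          (if s ! 1 = None \<and> s ! 3 = None then 1 else 4, map (\<lambda>i. (s ! i, Stay)) [0, 1, 2, 3, 4]))
     else if q < 3 + c then
       (Suc q, [(Some True, Rgt), (s ! 1, Stay), (Some False, Rgt), (s ! 3, Stay), (s ! 4, Stay)])
     else
       (if s ! 4 = None then 2 else 3,
        [(Some True, Rgt), (s ! 1, Rgt), (Some False, Rgt), (s ! 3, Lft), (Some True, Stay)]))"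

definition pad_otm :: "nat \<Rightarrow> otm" where
  "pad_otm c = \<lparr>n_tapes = 5, n_states = 4 + c, trans = pad_trans c\<rparr>"

lemma wf_pad_otm: "0 < c \<Longrightarrow> wf_otm 1 (pad_otm c)"
  by (auto simp: wf_otm_def pad_otm_def pad_trans_def split: option.split)

context
  fixes c :: nat and \<phi> :: "bits \<Rightarrow> bits"
begin

abbreviation "pad_step \<equiv> otm_step (pad_otm c) \<phi>"

section \<open>Runs of the machine, phase by phase\<close>

lemma copy_input:
  assumes "k \<le> length a"
  shows "(pad_step ^^ k) (0, [(cells [], 0), t1, t2, (cells a, 0), t4])
    = (0, [(cells (take k a), int k), t1, t2, (cells a, int k), t4])"
  using assms
proof (induction k)
  case (Suc k)
  have w: "(cells (take k a))(int k := Some (a ! k)) = cells (take (Suc k) a)"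
    using Suc.prems cells_snoc[of "take k a" "a ! k"] by (simp add: take_Suc_conv_app_nth)
  have r: "cells a (int k) = Some (a ! k)"
    using Suc.prems by (simp add: cells_eq)
  have "(pad_step ^^ Suc k) (0, [(cells [], 0), t1, t2, (cells a, 0), t4])
    = pad_step (0, [(cells (take k a), int k), t1, t2, (cells a, int k), t4])"
    using Suc by simp
  also have "\<dots> = (0, [(cells (take (Suc k) a), int (Suc k)), t1, t2, (cells a, int (Suc k)), t4])"
    using w r by (cases t1; cases t2; cases t4)
      (simp add: pad_otm_def pad_trans_def read_tape_def fun_upd_idem_iff)
  finally show ?case .
qed simp

lemma copy_answer:
  assumes "k \<le> length v"
  shows "(pad_step ^^ k) (3, [t0, (cells v, 0), (cells [], 0), t3, (cells [], 0)])
    = (3, [t0, (cells v, int k), (cells (take k v), int k), t3, (cells [], 0)])"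
  using assms
proof (induction k)
  case (Suc k)
  have w: "(cells (take k v))(int k := Some (v ! k)) = cells (take (Suc k) v)"
    using Suc.prems cells_snoc[of "take k v" "v ! k"] by (simp add: take_Suc_conv_app_nth)
  have r: "cells v (int k) = Some (v ! k)"
    using Suc.prems by (simp add: cells_eq)
  have e: "cells [] 0 = None" "(cells [])(0 := None) = cells []"
    by (auto simp: cells_eq)
  have "(pad_step ^^ Suc k) (3, [t0, (cells v, 0), (cells [], 0), t3, (cells [], 0)])
    = pad_step (3, [t0, (cells v, int k), (cells (take k v), int k), t3, (cells [], 0)])"
    using Suc by simp
  also have "\<dots> = (3, [t0, (cells v, int (Suc k)), (cells (take (Suc k) v), int (Suc k)), t3, (cells [], 0)])"
    using w r e by (cases t0; cases t3)
      (simp add: pad_otm_def pad_trans_def read_tape_def fun_upd_idem_iff)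
  finally show ?case .
qed simp

lemma chain_prefix:
  assumes "k < c"
  shows "(pad_step ^^ k) (4, [(cells u, int (length u)), t1, (cells w, int (length w)), t3, t4])
    = (4 + k, [(cells (u @ replicate k True), int (length u + k)), t1,
          (cells (w @ replicate k False), int (length w + k)), t3, t4])"
  using assms
proof (induction k)
  case (Suc k)
  have "(pad_step ^^ Suc k) (4, [(cells u, int (length u)), t1, (cells w, int (length w)), t3, t4])
    = pad_step (4 + k, [(cells (u @ replicate k True), int (length u + k)), t1,
          (cells (w @ replicate k False), int (length w + k)), t3, t4])"
    using Suc by simp
  also have "\<dots> = (4 + Suc k, [(cells (u @ replicate (Suc k) True), int (length u + Suc k)), t1,
          (cells (w @ replicate (Suc k) False), int (length w + Suc k)), t3, t4])"
    using Suc.prems cells_snoc[of "u @ replicate k True" True] cells_snoc[of "w @ replicate k False" False]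
    by (cases t1; cases t3; cases t4)
      (simp add: pad_otm_def pad_trans_def read_tape_def fun_upd_idem_iff
        replicate_append_same add.commute add.left_commute)
  finally show ?case .
qed simp

text \<open>One chain serves both phases: with tape 4 still blank it ends in the query state, later
  it returns to state \<open>3\<close>. The input head moves left because copying has left it just
  behind the input.\<close>

lemma chain:
  assumes "0 < c"
  shows "(pad_step ^^ c) (4, [(cells u, int (length u)), (c1, h1), (cells w, int (length w)), (c3, h3), (c4, h4)])
    = (if c4 h4 = None then 2 else 3,
        [(cells (u @ replicate c True), int (length u + c)), (c1, h1 + 1),
          (cells (w @ replicate c False), int (length w + c)), (c3, h3 - 1), (c4(h4 := Some True), h4)])"
proof -
  obtain k where c: "c = Suc k"
    using assms by (cases c) auto
  have "(pad_step ^^ c) (4, [(cells u, int (length u)), (c1, h1), (cells w, int (length w)), (c3, h3), (c4, h4)])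
    = pad_step (4 + k, [(cells (u @ replicate k True), int (length u + k)), (c1, h1),
          (cells (w @ replicate k False), int (length w + k)), (c3, h3), (c4, h4)])"
    using chain_prefix[of k u "(c1, h1)" w "(c3, h3)" "(c4, h4)"] by (simp add: c)
  then show ?thesis
    using cells_snoc[of "u @ replicate k True" True] cells_snoc[of "w @ replicate k False" False]
    by (simp add: pad_otm_def pad_trans_def read_tape_def fun_upd_idem_iff c
        replicate_append_same add.commute add.left_commute)
qed

text \<open>A round costs one test in state \<open>3\<close> and \<open>c\<close> steps of the
  chain. As long as \<open>k\<close> is below the maximum, the answer head at \<open>k\<close> or
  the input head at \<open>length a - 1 - k\<close> still reads a symbol. The query tape merely
  collects further ones, so its content \<open>u'\<close> is left open.\<close>

lemma pad_rounds:
  assumes "0 < c" and "c4 h4 \<noteq> None" and "k \<le> max (length v) (length a)"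
  shows "\<exists>c4' u'. c4' h4 \<noteq> None \<and>
    (pad_step ^^ (k * Suc c))
      (3, [(cells u, int (length u)), (cells v, 0), (cells w, int (length w)), (cells a, int (length a) - 1), (c4, h4)])
    = (3, [(cells u', int (length u')), (cells v, int k),
        (cells (w @ replicate (k * c) False), int (length w + k * c)), (cells a, int (length a) - 1 - int k), (c4', h4)])"
  using assms(3)
proof (induction k)
  case 0
  then show ?case using assms by auto
next
  case (Suc k)
  let ?S = "(3, [(cells u, int (length u)), (cells v, 0), (cells w, int (length w)), (cells a, int (length a) - 1), (c4, h4)])"
  let ?w = "w @ replicate (k * c) False"
  obtain c4' u' where c4': "c4' h4 \<noteq> None" and
    IH: "(pad_step ^^ (k * Suc c)) ?S
      = (3, [(cells u', int (length u')), (cells v, int k),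
        (cells ?w, int (length w + k * c)), (cells a, int (length a) - 1 - int k), (c4', h4)])"
    using Suc by auto
  have nb: "cells v (int k) \<noteq> None \<or> cells a (int (length a) - 1 - int k) \<noteq> None"
    using Suc.prems by (auto simp: cells_eq)
  have "(pad_step ^^ (Suc k * Suc c)) ?S = (pad_step ^^ (c + 1)) ((pad_step ^^ (k * Suc c)) ?S)"
    unfolding o_apply[of "pad_step ^^ (c + 1)", symmetric] funpow_add[symmetric]
    by (simp add: algebra_simps)
  also have "\<dots> = (pad_step ^^ c) (4, [(cells u', int (length u')), (cells v, int k),
        (cells ?w, int (length ?w)), (cells a, int (length a) - 1 - int k), (c4', h4)])"
    unfolding IH funpow_add using nb c4'
    by (auto simp: pad_otm_def pad_trans_def read_tape_def fun_upd_idem_iff)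
  also have "\<dots> = (3, [(cells (u' @ replicate c True), int (length (u' @ replicate c True))), (cells v, int (Suc k)),
        (cells (w @ replicate (Suc k * c) False), int (length w + Suc k * c)),
        (cells a, int (length a) - 1 - int (Suc k)), (c4'(h4 := Some True), h4)])"
    unfolding chain[OF assms(1)] using c4'
    by (simp add: replicate_add[symmetric] add.commute add.left_commute)
  finally show ?case by (metis fun_upd_same option.discI)
qed

lemma pad_otm_computes:
  assumes "0 < c"
  defines "v \<equiv> \<lambda>a. \<phi> (a @ replicate c True)"
  shows "computes_within (pad_otm c) \<phi> [a]
    (\<phi> a @ replicate (c + max (length (v a)) (length a) * c) False)
    (length a + length (\<phi> a) + c + max (length (v a)) (length a) * Suc c + 5)"
proof -
  let ?k = "max (length (v a)) (length a)"
  let ?e = "(cells [], 0 :: int)"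
  let ?n = "int (length a)"
  have e: "cells [] 0 = None" "(cells [])(0 := None) = cells []"
    by (auto simp: cells_eq)
  have end': "cells w (int (length w)) = None" "(cells w)(int (length w) := None) = cells w" for w
    by (auto simp: cells_eq)
  have one: "(pad_step ^^ 1) x = pad_step x" for x
    by simp
  have init: "init_config (pad_otm c) [a] = (0, [?e, ?e, ?e, (cells a, 0), ?e])"
    by (simp add: init_config_def pad_otm_def string_tape_cells numeral_eq_Suc)
  have 1: "(pad_step ^^ length a) (0, [?e, ?e, ?e, (cells a, 0), ?e])
      = (0, [(cells a, ?n), ?e, ?e, (cells a, ?n), ?e])"
    using copy_input[of "length a" a] by simp
  have 2: "(pad_step ^^ 2) (0, [(cells a, ?n), ?e, ?e, (cells a, ?n), ?e])
      = (3, [(cells a, ?n), (cells (\<phi> a), 0), ?e, (cells a, ?n), ?e])"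
    by (simp add: numeral_2_eq_2 pad_otm_def pad_trans_def read_tape_def fun_upd_idem_iff e end'
        tape_string_cells string_tape_cells)
  have 3: "(pad_step ^^ length (\<phi> a)) (3, [(cells a, ?n), (cells (\<phi> a), 0), ?e, (cells a, ?n), ?e])
      = (3, [(cells a, ?n), (cells (\<phi> a), int (length (\<phi> a))), (cells (\<phi> a), int (length (\<phi> a))),
          (cells a, ?n), ?e])"
    using copy_answer[of "length (\<phi> a)" "\<phi> a"] by simp
  have 4: "pad_step (3, [(cells a, ?n), (cells (\<phi> a), int (length (\<phi> a))), (cells (\<phi> a), int (length (\<phi> a))),
          (cells a, ?n), ?e])
      = (4, [(cells a, ?n), (cells (\<phi> a), int (length (\<phi> a))), (cells (\<phi> a), int (length (\<phi> a))),
          (cells a, ?n), ?e])"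
    by (simp add: pad_otm_def pad_trans_def read_tape_def fun_upd_idem_iff e end')
  have 5: "(pad_step ^^ c) (4, [(cells a, ?n), (cells (\<phi> a), int (length (\<phi> a))), (cells (\<phi> a), int (length (\<phi> a))),
          (cells a, ?n), ?e])
      = (2, [(cells (a @ replicate c True), int (length (a @ replicate c True))), (cells (\<phi> a), int (length (\<phi> a)) + 1),
          (cells (\<phi> a @ replicate c False), int (length (\<phi> a @ replicate c False))),
          (cells a, ?n - 1), ((cells [])(0 := Some True), 0)])"
    unfolding chain[OF assms(1)] by (simp add: e)
  have 6: "pad_step (2, [(cells (a @ replicate c True), int (length (a @ replicate c True))), (cells (\<phi> a), int (length (\<phi> a)) + 1),
          (cells (\<phi> a @ replicate c False), int (length (\<phi> a @ replicate c False))),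
          (cells a, ?n - 1), ((cells [])(0 := Some True), 0)])
      = (3, [(cells (a @ replicate c True), int (length (a @ replicate c True))), (cells (v a), 0),
          (cells (\<phi> a @ replicate c False), int (length (\<phi> a @ replicate c False))),
          (cells a, ?n - 1), ((cells [])(0 := Some True), 0)])"
    by (simp add: tape_string_cells string_tape_cells v_def)
  obtain c4 u where c4: "c4 0 \<noteq> None" and
    7: "(pad_step ^^ (?k * Suc c)) (3, [(cells (a @ replicate c True), int (length (a @ replicate c True))), (cells (v a), 0),
          (cells (\<phi> a @ replicate c False), int (length (\<phi> a @ replicate c False))),
          (cells a, ?n - 1), ((cells [])(0 := Some True), 0)])
      = (3, [(cells u, int (length u)), (cells (v a), int ?k),
        (cells ((\<phi> a @ replicate c False) @ replicate (?k * c) False), int (length (\<phi> a @ replicate c False) + ?k * c)),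
        (cells a, int (length a) - 1 - int ?k), (c4, 0)])"
    using pad_rounds[OF assms(1), of "(cells [])(0 := Some True)" 0 ?k "v a" a "a @ replicate c True"
        "\<phi> a @ replicate c False"] by auto
  have blank: "cells (v a) (int ?k) = None" "cells a (?n - 1 - int ?k) = None"
    by (auto simp: cells_eq)
  let ?end = "(1, [(cells u, int (length u)), (cells (v a), int ?k),
        (cells ((\<phi> a @ replicate c False) @ replicate (?k * c) False), int (length (\<phi> a @ replicate c False) + ?k * c)),
        (cells a, int (length a) - 1 - int ?k), (c4, 0)])"
  have 8: "pad_step (3, [(cells u, int (length u)), (cells (v a), int ?k),
        (cells ((\<phi> a @ replicate c False) @ replicate (?k * c) False), int (length (\<phi> a @ replicate c False) + ?k * c)),
        (cells a, int (length a) - 1 - int ?k), (c4, 0)]) = ?end"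
    using c4 blank by (auto simp: pad_otm_def pad_trans_def read_tape_def fun_upd_idem_iff)
  \<comment> \<open>From right to left: copying the input, reaching the query state and querying,
    copying the answer, entering the chain, its first pass, the second query, the rounds,
    halting.\<close>
  have "(pad_step ^^ (1 + (?k * Suc c + (1 + (c + (1 + (length (\<phi> a) + (2 + length a)))))))) (init_config (pad_otm c) [a]) = ?end"
    unfolding funpow_add o_apply init 1 2 3 one 4 5 6 7 8 ..
  then show ?thesis
    unfolding computes_within_def
    by (intro exI[of _ "1 + (?k * Suc c + (1 + (c + (1 + (length (\<phi> a) + (2 + length a))))))"] conjI exI)
      (auto simp: tape_string_cells replicate_add)
qed

end

section \<open>Second-order polynomial time bounds\<close>

lemma second_order_poly_const: "second_order_poly (\<lambda>l n. k)"
  using second_order_poly.base[of "[:int k:]"] by simp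

lemma second_order_poly_id: "second_order_poly (\<lambda>l n. n)"
  using second_order_poly.base[of "[:0, 1:]"] by simp

lemmas second_order_poly_intros =
  second_order_poly_const second_order_poly_id second_order_poly.add second_order_poly.mult second_order_poly.app

text \<open>Second-order polynomials are built from sums and products, so a sum stands for the
  maximum that counts the rounds.\<close>

lemma second_order_poly_pad_time:
  "second_order_poly (\<lambda>l n. n + l n + c + (l (n + c) + n) * Suc c + 5)"
  by (intro second_order_poly_intros)

lemma computes_within_mono: "computes_within M \<phi> ws v t \<Longrightarrow> t \<le> t' \<Longrightarrow> computes_within M \<phi> ws v t'"
  unfolding computes_within_def using order_trans by blast

section \<open>The inclusion of the Sobolev space\<close>

lemma interval_lebesgue_integral_eq_integral:
  fixes f :: "real \<Rightarrow> real"
  assumes f: "integrable unit_leb f" and b: "0 \<le> b" "b \<le> 1"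
  shows "(LINT x=ereal 0..ereal b|lebesgue. f x) = integral {0..b} f"
proof -
  have "f absolutely_integrable_on {0..1}"
    using f by (simp add: integrable_lebesgue_on_iff_absolutely)
  then have "set_integrable lebesgue {0<..<b} f"
    by (rule set_integrable_subset) (use b in auto)
  then have "(LINT x:{0<..<b}|lebesgue. f x) = integral {0<..<b} f"
    by (rule set_lebesgue_integral_eq_integral)
  also have "\<dots> = integral {0..b} f"
    by (simp add: integral_open_interval_real)
  finally show ?thesis
    using b by (simp add: interval_lebesgue_integral_le_eq)
qed

lemma Lp_fun_AE_cong:
  assumes "f \<in> Lp_fun p" "g \<in> borel_measurable unit_leb" "AE x in unit_leb. g x = f x"
  shows "g \<in> Lp_fun p"
proof -
  have [measurable]: "f \<in> borel_measurable unit_leb" "g \<in> borel_measurable unit_leb"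
    using assms by (auto simp: Lp_fun_def)
  have "integrable unit_leb (\<lambda>x. \<bar>g x\<bar> powr p) = integrable unit_leb (\<lambda>x. \<bar>f x\<bar> powr p)"
    using assms(3) by (intro integrable_cong_AE) (measurable, auto elim: eventually_mono)
  then show ?thesis
    using assms by (simp add: Lp_fun_def)
qed

text \<open>A name provides some representative \<open>f\<close> and some version \<open>g\<close>
  of its derivative, while membership in the Sobolev space speaks of possibly different ones;
  uniqueness almost everywhere transfers the integrability.\<close>

lemma sobolev_mem:
  assumes "F \<in> sobolev m p" "f \<in> F" "weak_deriv_iter m f g" "1 \<le> m"
  shows "f \<in> Lp_fun p" "g \<in> Lp_fun p"
proof -
  obtain f0 where f0: "f0 \<in> sobolev_fun m p" "F = ae_class f0"
    using assms(1) by (auto simp: sobolev_def)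
  have f: "f \<in> borel_measurable unit_leb" "AE x in unit_leb. f x = f0 x"
    using assms(2) f0 by (auto simp: ae_class_def)
  show "f \<in> Lp_fun p"
    using f0 f by (auto simp: sobolev_fun_def intro: Lp_fun_AE_cong[of f0 p f])
  obtain g0 where g0: "weak_deriv_iter m f0 g0" "g0 \<in> Lp_fun p"
  proof -
    have "m \<in> {1..m}"
      using assms(4) by simp
    then show ?thesis
      using f0(1) that unfolding sobolev_fun_def by blast
  qed
  obtain w where "weak_deriv w g"
    using assms(3,4) by (cases m) auto
  then have "g \<in> borel_measurable unit_leb"
    using weak_deriv_integrable by blast
  then show "g \<in> Lp_fun p"
    using Lp_fun_AE_cong[OF g0(2)] weak_deriv_iter_AE_unique[OF assms(3) g0(1) f(2)] by blast
qed

lemma sobolev_subset_Lp_space: "sobolev m p \<subseteq> Lp_space p"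
  by (auto simp: sobolev_def Lp_space_def sobolev_fun_def)

section \<open>Sizes of padded names\<close>

lemma fsize_mono: "length_monotone \<phi> \<Longrightarrow> i \<le> j \<Longrightarrow> fsize \<phi> i \<le> fsize \<phi> j"
  by (simp add: length_monotone_def fsize_def)

text \<open>For length-monotone \<open>\<phi>\<close>, the query of length
  \<open>length a + c\<close> has an answer at least as long as that to any query of length at most
  \<open>c\<close>, whatever \<open>a\<close> is, and the length of the result depends on
  \<open>length a\<close> only.\<close>

definition pad_name :: "nat \<Rightarrow> (bits \<Rightarrow> bits) \<Rightarrow> bits \<Rightarrow> bits" where
  "pad_name c \<phi> a =
    \<phi> a @ replicate (c + max (length (\<phi> (a @ replicate c True))) (length a) * c) False"

lemma length_pad_name:
  assumes "length_monotone \<phi>"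
  shows "length (pad_name c \<phi> a)
    = fsize \<phi> (length a) + c + max (fsize \<phi> (length a + c)) (length a) * c"
  using fsize_length[OF assms, of a] fsize_length[OF assms, of "a @ replicate c True"]
  by (simp add: pad_name_def)

lemma fsize_pad_name:
  assumes "length_monotone \<phi>"
  shows "fsize (pad_name c \<phi>) n = fsize \<phi> n + c + max (fsize \<phi> (n + c)) n * c"
  using length_pad_name[OF assms, of c "replicate n True"] by (simp add: fsize_def)

lemma length_monotone_pad_name:
  assumes "length_monotone \<phi>"
  shows "length_monotone (pad_name c \<phi>)"
  unfolding length_monotone_def
proof (intro allI impI)
  fix a b :: bits assume le: "length a \<le> length b"
  have "max (fsize \<phi> (length a + c)) (length a) \<le> max (fsize \<phi> (length b + c)) (length b)"
    using le fsize_mono[OF assms, of "length a + c" "length b + c"] by auto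
  then show "length (pad_name c \<phi> a) \<le> length (pad_name c \<phi> b)"
    unfolding length_pad_name[OF assms] using le fsize_mono[OF assms, of "length a" "length b"]
    by (intro add_mono mult_right_mono) auto
qed

lemma dyadic_pad_name: "dyadic (pad_name c \<phi> a) = dyadic (\<phi> a)"
  by (simp add: pad_name_def dyadic_append_zeros)

lemma pad_name_computable:
  assumes "0 < c" "length_monotone \<phi>"
  shows "computes_within (pad_otm c) \<phi> [a] (pad_name c \<phi> a)
    (length a + fsize \<phi> (length a) + c + (fsize \<phi> (length a + c) + length a) * Suc c + 5)"
proof -
  have e: "length (\<phi> a) = fsize \<phi> (length a)" "length (\<phi> (a @ replicate c True)) = fsize \<phi> (length a + c)"
    using fsize_length[OF assms(2), of a] fsize_length[OF assms(2), of "a @ replicate c True"] by auto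
  have "max (fsize \<phi> (length a + c)) (length a) * Suc c \<le> (fsize \<phi> (length a + c) + length a) * Suc c"
    by (intro mult_right_mono) auto
  then show ?thesis
    using computes_within_mono[OF pad_otm_computes[OF assms(1), of \<phi> a]] unfolding pad_name_def e
    by auto
qed

theorem theorem4p10:
  fixes pr :: "bits \<Rightarrow> bits \<Rightarrow> bits" and p :: real and m :: nat
  assumes "admissible_pairing pr" and "1 \<le> p" and "1 \<le> m"
  shows "polytime_computable (sobolev m p) (xi pr m p) (Lp_space p) (xi pr 0 p) (\<lambda>F. F)"
proof -
  have "\<exists>b. dyadic b = real i / 2 ^ m" if "i \<le> m" for i
    using that less_exp[of m] by (intro ex_dyadic) linarith
  then obtain b where b: "\<And>i. i \<le> m \<Longrightarrow> dyadic (b i) = real i / 2 ^ m"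
    by metis
  \<comment> \<open>\<open>c0\<close> bounds the lengths of the queries for the integrals from 0 to
    the grid points with error below 1; the empty string codes both the end point 0 and the
    precision 0.\<close>
  define c0 where "c0 = (\<Sum>i\<le>m. length (pr [] (pr (b i) [])))"
  define q where "q = nat \<lceil>p\<rceil>"
  define X :: nat where "X = (2 * 2 ^ m) ^ m"
  \<comment> \<open>If \<open>B\<close> and \<open>N\<close> are both \<open>2 * 2 ^ L\<close>, then
    \<open>K\<close> has to be at least \<open>2 ^ L * C\<close>, and \<open>2 ^ (L + C)\<close>
    is.\<close>
  define C where "C = 4 * (m * X + 1)"
  \<comment> \<open>The first summand makes \<open>fsize \<phi> (n + c)\<close> dominate
    \<open>L\<close>. Since \<open>n\<close> and \<open>L\<close> are both at most the number of
    rounds, \<open>2 * q\<close> zeros per round cover \<open>q * (n + L)\<close>. The rest covers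
    the remaining \<open>q * C + 2\<close> of the exponent.\<close>
  define c where "c = c0 + 2 * q + (q * C + 2)"
  have pq: "p \<le> real q"
    unfolding q_def by linarith
  have c_pos: "0 < c"
    by (simp add: c_def)
  have name: "xi pr 0 p (pad_name c \<phi>) F" if xi: "xi pr m p \<phi> F" for \<phi> F
  proof -
    from xi obtain f g where mono: "length_monotone \<phi>" and F: "F \<in> sobolev m p" "f \<in> F"
      and approx: "\<And>a b n. dyadic a \<in> {0..1} \<Longrightarrow> dyadic b \<in> {0..1} \<Longrightarrow>
           \<bar>(LINT x=ereal (dyadic a)..ereal (dyadic b)|lebesgue. f x)
              - dyadic (\<phi> (pr a (pr b (replicate n True))))\<bar> < (1 / 2) ^ n"
      and g: "weak_deriv_iter m f g" "Lp_modulus p g (fsize \<phi>)"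
      unfolding xi_def by blast
    have fL: "f \<in> Lp_fun p" and gL: "g \<in> Lp_fun p"
      using sobolev_mem[OF F g(1) assms(3)] by auto
    define L where "L = fsize \<phi> c0"
    have L0: "fsize \<phi> 0 \<le> L"
      unfolding L_def by (rule fsize_mono[OF mono]) simp
    have gN: "(LINT x|unit_leb. \<bar>g x\<bar>) \<le> 2 * 2 ^ L"
    proof -
      have "(LINT x|unit_leb. \<bar>g x\<bar>) \<le> 2 * 2 ^ fsize \<phi> 0"
      proof (rule integral_abs_le_of_shift[OF gL assms(2)])
        have "Lp_norm p (\<lambda>x. zero_ext g x - zero_ext g (x + h)) < (1 / 2) ^ 0"
          if "\<bar>h\<bar> \<le> (1 / 2) ^ fsize \<phi> 0" for h
          using g(2) that unfolding Lp_modulus_def by blast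
        from this[of "(1 / 2) ^ fsize \<phi> 0"]
        show "Lp_norm p (\<lambda>x. zero_ext g x - zero_ext g (x + (1 / 2) ^ fsize \<phi> 0)) < 1"
          by simp
      qed
      also have "\<dots> \<le> 2 * 2 ^ L"
        using L0 by simp
      finally show ?thesis .
    qed
    have B: "\<bar>integral {0..real i / 2 ^ m} f\<bar> \<le> 2 * 2 ^ L" if i: "i \<le> m" for i
    proof -
      have "i \<le> 2 ^ m"
        using i less_exp[of m] by linarith
      then have i1: "0 \<le> real i / 2 ^ m" "real i / 2 ^ m \<le> 1"
        by auto
      let ?w = "pr [] (pr (b i) [])"
      have "\<bar>integral {0..real i / 2 ^ m} f - dyadic (\<phi> ?w)\<bar> < 1"
        using approx[of "[]" "b i" 0] b[OF i] i1 fL assms(2)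
        by (simp add: interval_lebesgue_integral_eq_integral Lp_fun_integrable)
      moreover have "\<bar>dyadic (\<phi> ?w)\<bar> \<le> 2 ^ L"
      proof -
        have "length ?w \<le> c0"
          unfolding c0_def using i by (intro member_le_sum) auto
        then have "length (\<phi> ?w) \<le> L"
          using fsize_length[OF mono, of ?w] fsize_mono[OF mono, of "length ?w" c0] by (simp add: L_def)
        then show ?thesis
          using abs_dyadic_le[of "\<phi> ?w"] power_increasing[of "length (\<phi> ?w)" L "2::real"] by linarith
      qed
      moreover have "1 \<le> (2::real) ^ L"
        by simp
      ultimately show ?thesis
        by linarith
    qed
    have KC: "2 * (real m * ((2 * 2 ^ m) ^ m * (2 * 2 ^ L)) + 2 * 2 ^ L) \<le> (2::real) ^ (L + C)"
    proof -
      have "(2 * 2 ^ m) ^ m = real X"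
        by (simp add: X_def)
      then have "2 * (real m * ((2 * 2 ^ m) ^ m * (2 * 2 ^ L)) + 2 * 2 ^ L) = 2 ^ L * real C"
        by (simp only: C_def of_nat_mult of_nat_add) (simp add: algebra_simps)
      also have "\<dots> \<le> 2 ^ L * 2 ^ C"
        by (intro mult_left_mono less_imp_le of_nat_less_two_power) auto
      finally show ?thesis
        by (simp add: power_add)
    qed
    have "Lp_modulus p f (fsize (pad_name c \<phi>))"
      unfolding Lp_modulus_def
    proof (intro conjI allI impI)
      fix n h assume h: "\<bar>h\<bar> \<le> (1 / 2 :: real) ^ fsize (pad_name c \<phi>) n"
      have "\<bar>h\<bar> \<le> 1"
        using h by (rule order_trans) (simp add: power_le_one)
      then have I: "(LINT x|lebesgue. \<bar>zero_ext f x - zero_ext f (x + h)\<bar> powr p)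
          \<le> 3 * \<bar>h\<bar> * (2 ^ (L + C)) powr p"
        by (intro sobolev_shift_integral_le[OF assms(2,3) g(1) gN B _ KC]) simp_all
      have "q * (n + (L + C)) + 2 \<le> fsize (pad_name c \<phi>) n"
      proof -
        have "L \<le> fsize \<phi> (n + c)"
          unfolding L_def by (rule fsize_mono[OF mono]) (simp add: c_def)
        then have "n + L \<le> max (fsize \<phi> (n + c)) n * 2"
          by auto
        then have "q * (n + L) \<le> max (fsize \<phi> (n + c)) n * (2 * q)"
          using mult_le_mono2[of "n + L" _ q] by (simp add: mult_ac)
        also have "\<dots> \<le> max (fsize \<phi> (n + c)) n * c"
          by (intro mult_le_mono2) (simp add: c_def)
        finally have "q * (n + L) \<le> max (fsize \<phi> (n + c)) n * c" .
        moreover have "q * C + 2 \<le> c"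
          by (simp add: c_def)
        moreover have "q * (n + (L + C)) + 2 = q * (n + L) + (q * C + 2)"
          by (simp add: algebra_simps)
        ultimately show ?thesis
          unfolding fsize_pad_name[OF mono] by linarith
      qed
      then show "Lp_norm p (\<lambda>x. zero_ext f x - zero_ext f (x + h)) < (1 / 2) ^ n"
        by (rule Lp_norm_less_of_integral[OF assms(2) pq h _ I])
    next
      fix n
      \<comment> \<open>The given modulus may stagnate only at 0, and there the maximum equals
        \<open>n\<close>, which grows.\<close>
      have "fsize \<phi> (n + c) < fsize \<phi> (Suc n + c) \<or> fsize \<phi> (n + c) = 0"
        using g(2) by (auto simp: Lp_modulus_def)
      then have "max (fsize \<phi> (n + c)) n < max (fsize \<phi> (Suc n + c)) (Suc n)"
        by auto
      then have "max (fsize \<phi> (n + c)) n * c < max (fsize \<phi> (Suc n + c)) (Suc n) * c"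
        using c_pos by simp
      then show "fsize (pad_name c \<phi>) n < fsize (pad_name c \<phi>) (Suc n)"
        using fsize_mono[OF mono, of n "Suc n"] unfolding fsize_pad_name[OF mono] by linarith
    qed
    moreover have "F \<in> sobolev 0 p"
      using F(1) sobolev_subset_Lp_space by (auto simp: sobolev_0)
    moreover have "weak_deriv_iter 0 f f"
      by simp
    ultimately show ?thesis
      unfolding xi_def dyadic_pad_name using approx F(2) length_monotone_pad_name[OF mono] by blast
  qed
  show ?thesis
    unfolding polytime_computable_def
  proof (intro conjI exI allI ballI impI)
    show "wf_otm 1 (pad_otm c)"
      using c_pos by (rule wf_pad_otm)
    show "second_order_poly (\<lambda>l n. n + l n + c + (l (n + c) + n) * Suc c + 5)"
      by (rule second_order_poly_pad_time)
  next
    fix \<phi> F assume "length_monotone \<phi> \<and> xi pr m p \<phi> F"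
    then show "xi pr 0 p (pad_name c \<phi>) F"
      using name by blast
  next
    fix \<phi> F a assume "length_monotone \<phi> \<and> xi pr m p \<phi> F"
    then show "computes_within (pad_otm c) \<phi> [a] (pad_name c \<phi> a)
        (length a + fsize \<phi> (length a) + c + (fsize \<phi> (length a + c) + length a) * Suc c + 5)"
      using pad_name_computable[OF c_pos] by blast
  qed (use sobolev_subset_Lp_space in auto)
qed

end
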